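(* Let $X_1,X_2,\ldots$ and $Y_1,Y_2,\ldots$ be two independent sequences of independent non-negative random variables with common distribution functions $F$ and $G$ respectively, where $F$ and $G$ have densities and finite positive means $\mu_F$ and $\mu_G$. For $n,m\ge 2$ put $N=n+m$, and let $\delta_F,\delta_G$, $\hat\delta_F$ (based on $X_1,\ldots,X_n$), $\hat\delta_G$ (based on $Y_1,\ldots,Y_m$), $\delta(F,G)=\delta_F-\delta_G$ and $\hat\delta(F,G)=\hat\delta_F-\hat\delta_G$ be as defined in the context. Suppose that $$E\Big[\max\{X_1,X_2\}-\tfrac{\delta_F}{2}(X_1+X_2)\Big]^2<\infty\quad\text{and}\quad E\Big[\max\{Y_1,Y_2\}-\tfrac{\delta_G}{2}(Y_1+Y_2)\Big]^2<\infty,$$ and that $n,m\to\infty$ in such a way that $\frac nN\to c$ for some $c\in(0,\tfrac12]$. Then $\sqrt N\,(\hat\delta(F,G)-\delta(F,G))$ is asymptotically normal with mean $0$ and variance $$\sigma^2_{F,G}=\frac Nn\,\sigma_F^2+\frac Nm\,\sigma_G^2,$$ i.e. $\sqrt N\,(\hat\delta(F,G)-\delta(F,G))/\sigma_{F,G}$ converges in distribution to the standard normal law $N(0,1)$, where $$\sigma_F^2=\frac{4}{\mu_F^2}\,\mathrm{Var}\left(XF(X)+\int_{X}^{\infty}t\,dF(t)-\frac{\delta_F}{2}X\right),\qquad \sigma_G^2=\frac{4}{\mu_G^2}\,\mathrm{Var}\left(YG(Y)+\int_{Y}^{\infty}t\,dG(t)-\frac{\delta_G}{2}Y\right),$$ with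 $X$ having distribution function $F$ and $Y$ having distribution function $G$.
   Context: For a distribution function $H$ of a non-negative random variable with finite positive mean $\mu_H$, set $\mu_H^{(2)}=E[\max\{Z_1,Z_2\}]$ with $Z_1,Z_2$ independent with distribution function $H$, and $\delta_H=\mu_H^{(2)}/\mu_H$. The estimators are $$\hat\delta_F=\frac{\sum\sum_{i\ne j}\max\{X_i,X_j\}}{n(n-1)\bar X},\qquad \hat\delta_G=\frac{\sum\sum_{i\ne j}\max\{Y_i,Y_j\}}{m(m-1)\bar Y},$$ where $\bar X=\frac1n\sum_{i=1}^n X_i$, $\bar Y=\frac1m\sum_{i=1}^m Y_i$, and the double sums are over all ordered pairs $(i,j)$ of distinct indices in $\{1,\ldots,n\}$ and in $\{1,\ldots,m\}$ respectively. *)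

theory Defs
  imports "HOL-Probability.Probability"
begin

text \<open>
  A distribution function \<open>H\<close> is a function \<open>real \<Rightarrow> real\<close>; integrals \<open>\<dots> dH\<close> are integrals with
  respect to its Lebesgue--Stieltjes measure \<^term>\<open>interval_measure H\<close>, which is the law of a
  random variable with distribution function \<open>H\<close>.
\<close>

definition has_density :: "(real \<Rightarrow> real) \<Rightarrow> bool" where
  "has_density H \<longleftrightarrow>
     (\<exists>h :: real \<Rightarrow> ennreal. h \<in> borel_measurable lborel \<and> interval_measure H = density lborel h)"

definition df_mean :: "(real \<Rightarrow> real) \<Rightarrow> real" where
  "df_mean H = (\<integral>x. x \<partial>interval_measure H)"

text \<open>The two coordinates on the product space are independent with distribution function \<open>H\<close>.\<close>

definition df_mean_max :: "(real \<Rightarrow> real) \<Rightarrow> real" where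
  "df_mean_max H =
     (\<integral>z. max (fst z) (snd z) \<partial>(interval_measure H \<Otimes>\<^sub>M interval_measure H))"

definition delta :: "(real \<Rightarrow> real) \<Rightarrow> real" where
  "delta H = df_mean_max H / df_mean H"

definition sample_mean :: "nat \<Rightarrow> (nat \<Rightarrow> real) \<Rightarrow> real" where
  "sample_mean n x = (1 / real n) * (\<Sum>i<n. x i)"

text \<open>The sample of size \<open>n\<close> is \<open>x 0, \<dots>, x (n - 1)\<close>.\<close>

definition delta_hat :: "nat \<Rightarrow> (nat \<Rightarrow> real) \<Rightarrow> real" where
  "delta_hat n x =
     (\<Sum>(i, j) \<in> {(i, j). i < n \<and> j < n \<and> i \<noteq> j}. max (x i) (x j))
       / (real n * (real n - 1) * sample_mean n x)"

definition asymp_var :: "(real \<Rightarrow> real) \<Rightarrow> real" where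
  "asymp_var H =
     4 / (df_mean H)\<^sup>2 *
       prob_space.variance (interval_measure H)
         (\<lambda>x. x * H x + (LINT t:{x<..}|interval_measure H. t) - delta H / 2 * x)"

definition asymp_var2 ::
  "(real \<Rightarrow> real) \<Rightarrow> (real \<Rightarrow> real) \<Rightarrow> nat \<Rightarrow> nat \<Rightarrow> real" where
  "asymp_var2 F G n m =
     real (n + m) / real n * asymp_var F + real (n + m) / real m * asymp_var G"

end

theory Submission
  imports Defs
begin

text \<open>
Let \<open>\<mu>\<close> and \<open>\<delta>\<close> belong to one of the two laws, and put \<open>\<phi>(x, y) = max x y - \<delta>/2 (x + y)\<close>. Averaging
\<open>(X\<^sub>i + X\<^sub>j) / 2\<close> over ordered pairs of distinct indices gives the sample mean, so the error of the estimator
is almost surely \<open>U\<^sub>n / mean(X)\<close>, where \<open>U\<^sub>n\<close> is the U-statistic with kernel \<open>\<phi>\<close>;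
by the definition of \<open>\<delta>\<close> this kernel has mean 0.

Hajek's projection method splits the kernel as \<open>\<phi>(x, y) = proj x + proj y + resid(x, y)\<close>, where
\<open>proj x = E \<phi>(x, Z)\<close> and \<open>resid\<close> integrates to 0 in each argument (\<open>kernel_decomposition\<close>,
\<open>integral_resid\<close>). In the sum over pairs, residuals with different index sets are orthogonal, so their
contribution to \<open>U\<^sub>n\<close> has variance of order \<open>1 / n\<^sup>2\<close> (\<open>second_moment_resid_sum\<close>) and disappears on
the scale \<open>1 / sqrt n\<close>. What remains is \<open>2/n\<close> times a sum of independent centered variables
\<open>proj (X\<^sub>i)\<close>, which obeys the central limit theorem; and the sample mean in the denominator may be replaced
by \<open>\<mu>\<close> by the weak law of large numbers and Slutsky's theorem. This gives the limit law for one sample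
(\<open>normalized_error_clt\<close>).

Two points about the law are needed. The limiting variance is positive: \<open>E max(x, Z)\<close> is a convex function
of \<open>x\<close> with derivative \<open>F\<close>, so it could agree with an affine function of slope \<open>\<delta>/2\<close> almost everywhere
only if \<open>F\<close> were essentially equal to \<open>\<delta>/2\<close>, which a continuous distribution function is not
(\<open>not_AE_proj_zero\<close>). And square integrability of \<open>\<phi>\<close> forces a finite second moment, because
\<open>\<delta> < 2\<close> (\<open>square_integrable_id\<close>).

For the two samples, the normalized difference is a combination of the two independent normalized errors.
The squares of its coefficients add up to 1 and converge, so its characteristic function converges to
that of the standard normal law (\<open>weak_conv_m_indep_normal_combination\<close>).
\<close>

section \<open>Weak convergence through characteristic functions\<close>

text \<open>
Almost sure representatives with the given laws turn weak convergence into pointwise convergence, and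
then \<open>exp (i s\<^sub>n Y\<^sub>n)\<close> converges boundedly. The moving argument is what allows the deterministic
weights of the two samples to depend on the sample sizes.
\<close>

lemma char_tendsto_moving_argument:
  fixes \<mu> :: "nat \<Rightarrow> real measure"
  assumes \<mu>: "\<And>n. real_distribution (\<mu> n)" and \<nu>: "real_distribution \<nu>"
    and conv: "weak_conv_m \<mu> \<nu>" and s: "s \<longlonglongrightarrow> t"
  shows "(\<lambda>n. char (\<mu> n) (s n)) \<longlonglongrightarrow> char \<nu> t"
proof -
  obtain \<Omega> :: "real measure" and Y_seq :: "nat \<Rightarrow> real \<Rightarrow> real" and Y :: "real \<Rightarrow> real"
    where "prob_space \<Omega>"
      and Y_seq[measurable]: "\<And>n. Y_seq n \<in> borel_measurable \<Omega>"
      and distr_seq: "\<And>n. distr \<Omega> borel (Y_seq n) = \<mu> n"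
      and Y: "Y \<in> measurable \<Omega> lborel" and distr: "distr \<Omega> borel Y = \<nu>"
      and lim: "\<And>x. x \<in> space \<Omega> \<Longrightarrow> (\<lambda>n. Y_seq n x) \<longlonglongrightarrow> Y x"
    using Skorohod[OF \<mu> \<nu> conv] by blast
  interpret prob_space \<Omega> by fact
  have Y'[measurable]: "Y \<in> borel_measurable \<Omega>"
    using Y by simp
  have "(\<lambda>n. CLINT x|\<Omega>. iexp (s n * Y_seq n x)) \<longlonglongrightarrow> (CLINT x|\<Omega>. iexp (t * Y x))"
    by (rule integral_dominated_convergence[where w="\<lambda>_. 1"])
       (auto intro!: AE_I2 tendsto_intros s lim)
  then show ?thesis
    by (simp add: char_def distr_seq[symmetric] distr[symmetric] integral_distr)
qed

text \<open>
The bound has two regimes: \<open>\<bar>t\<bar> \<bar>U - V\<bar>\<close> is useful where the variables are close, and the constant 2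
takes over on the rare event where they are not.
\<close>

lemma (in prob_space) char_distr_diff_le:
  fixes U V :: "'a \<Rightarrow> real"
  assumes [measurable]: "random_variable borel U" "random_variable borel V"
  shows "cmod (char (distr M borel U) t - char (distr M borel V) t)
    \<le> expectation (\<lambda>\<omega>. min 2 (\<bar>t\<bar> * \<bar>U \<omega> - V \<omega>\<bar>))"
proof -
  have pointwise: "cmod (iexp (t * U \<omega>) - iexp (t * V \<omega>)) \<le> min 2 (\<bar>t\<bar> * \<bar>U \<omega> - V \<omega>\<bar>)" for \<omega>
  proof -
    have "iexp (t * U \<omega>) - iexp (t * V \<omega>) = iexp (t * V \<omega>) * (iexp (t * (U \<omega> - V \<omega>)) - 1)"
      by (simp add: algebra_simps exp_add[symmetric])
    then have eq: "cmod (iexp (t * U \<omega>) - iexp (t * V \<omega>)) = cmod (iexp (t * (U \<omega> - V \<omega>)) - 1)"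
      by (simp add: norm_mult)
    show ?thesis
      using iexp_approx1[of "t * (U \<omega> - V \<omega>)" 0] iexp_approx2[of "t * (U \<omega> - V \<omega>)" 0]
      unfolding eq by (simp add: abs_mult)
  qed
  have int: "integrable M (\<lambda>\<omega>. iexp (t * W \<omega>))" if [measurable]: "random_variable borel W" for W
    by (rule integrable_iexp) auto
  have "char (distr M borel U) t - char (distr M borel V) t
      = (CLINT \<omega>|M. iexp (t * U \<omega>) - iexp (t * V \<omega>))"
    by (subst Bochner_Integration.integral_diff[OF int[OF assms(1)] int[OF assms(2)]])
       (simp add: char_def integral_distr)
  also have "cmod \<dots> \<le> expectation (\<lambda>\<omega>. cmod (iexp (t * U \<omega>) - iexp (t * V \<omega>)))"
    by (rule integral_norm_bound)
  also have "\<dots> \<le> expectation (\<lambda>\<omega>. min 2 (\<bar>t\<bar> * \<bar>U \<omega> - V \<omega>\<bar>))"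
  proof (rule integral_mono)
    show "integrable M (\<lambda>\<omega>. cmod (iexp (t * U \<omega>) - iexp (t * V \<omega>)))"
      by (intro integrable_norm Bochner_Integration.integrable_diff int assms)
    show "integrable M (\<lambda>\<omega>. min 2 (\<bar>t\<bar> * \<bar>U \<omega> - V \<omega>\<bar>))"
      by (rule integrable_const_bound[of _ 2]) auto
  qed (rule pointwise)
  finally show ?thesis .
qed

lemma (in prob_space) weak_conv_m_transfer:
  fixes U V :: "nat \<Rightarrow> 'a \<Rightarrow> real"
  assumes U[measurable]: "\<And>n. random_variable borel (U n)"
    and V[measurable]: "\<And>n. random_variable borel (V n)"
    and \<nu>: "real_distribution \<nu>" and conv: "weak_conv_m (\<lambda>n. distr M borel (U n)) \<nu>"
    and close: "\<And>t. (\<lambda>n. expectation (\<lambda>\<omega>. min 2 (\<bar>t\<bar> * \<bar>V n \<omega> - U n \<omega>\<bar>))) \<longlonglongrightarrow> 0"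
  shows "weak_conv_m (\<lambda>n. distr M borel (V n)) \<nu>"
proof (rule levy_continuity)
  fix t
  have "(\<lambda>n. char (distr M borel (V n)) t - char (distr M borel (U n)) t) \<longlonglongrightarrow> 0"
    by (rule Lim_null_comparison[OF _ close[of t]]) (auto intro!: always_eventually char_distr_diff_le)
  moreover have "(\<lambda>n. char (distr M borel (U n)) t) \<longlonglongrightarrow> char \<nu> t"
    by (rule levy_continuity1[OF _ \<nu> conv]) simp
  ultimately show "(\<lambda>n. char (distr M borel (V n)) t) \<longlonglongrightarrow> char \<nu> t"
    by (rule Lim_transform[rotated])
qed (auto intro: \<nu>)

text \<open>
Slutsky's theorem for sums, with the perturbation controlled in mean.
\<close>

lemma (in prob_space) weak_conv_m_add_null:
  fixes U V :: "nat \<Rightarrow> 'a \<Rightarrow> real"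
  assumes U[measurable]: "\<And>n. random_variable borel (U n)"
    and V[measurable]: "\<And>n. random_variable borel (V n)"
    and \<nu>: "real_distribution \<nu>" and conv: "weak_conv_m (\<lambda>n. distr M borel (U n)) \<nu>"
    and int: "\<And>n. integrable M (\<lambda>\<omega>. V n \<omega> - U n \<omega>)"
    and close: "(\<lambda>n. expectation (\<lambda>\<omega>. \<bar>V n \<omega> - U n \<omega>\<bar>)) \<longlonglongrightarrow> 0"
  shows "weak_conv_m (\<lambda>n. distr M borel (V n)) \<nu>"
proof (rule weak_conv_m_transfer[OF U V \<nu> conv])
  fix t
  have "expectation (\<lambda>\<omega>. min 2 (\<bar>t\<bar> * \<bar>V n \<omega> - U n \<omega>\<bar>))
      \<le> expectation (\<lambda>\<omega>. \<bar>t\<bar> * \<bar>V n \<omega> - U n \<omega>\<bar>)" for n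
    by (intro integral_mono integrable_const_bound[of _ 2] integrable_mult_right integrable_abs int) auto
  moreover have "0 \<le> expectation (\<lambda>\<omega>. min 2 (\<bar>t\<bar> * \<bar>V n \<omega> - U n \<omega>\<bar>))" for n
    by (rule Bochner_Integration.integral_nonneg) auto
  ultimately have "\<forall>\<^sub>F n in sequentially. norm (expectation (\<lambda>\<omega>. min 2 (\<bar>t\<bar> * \<bar>V n \<omega> - U n \<omega>\<bar>)))
      \<le> \<bar>t\<bar> * expectation (\<lambda>\<omega>. \<bar>V n \<omega> - U n \<omega>\<bar>)"
    by (intro always_eventually allI) simp
  moreover have "(\<lambda>n. \<bar>t\<bar> * expectation (\<lambda>\<omega>. \<bar>V n \<omega> - U n \<omega>\<bar>)) \<longlonglongrightarrow> 0"
    using tendsto_mult_left[OF close, of "\<bar>t\<bar>"] by simp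
  ultimately show "(\<lambda>n. expectation (\<lambda>\<omega>. min 2 (\<bar>t\<bar> * \<bar>V n \<omega> - U n \<omega>\<bar>))) \<longlonglongrightarrow> 0"
    by (rule Lim_null_comparison)
qed

text \<open>
Slutsky's theorem for products. A bound on the first moments of \<open>U n\<close> plays the part of tightness: off
the event \<open>\<epsilon> \<le> \<bar>Q n - 1\<bar>\<close>, the factor \<open>Q n\<close> moves \<open>U n\<close> by at most \<open>\<epsilon> \<bar>U n\<bar>\<close>.
\<close>

lemma (in prob_space) weak_conv_m_mult_one:
  fixes U Q :: "nat \<Rightarrow> 'a \<Rightarrow> real"
  assumes U[measurable]: "\<And>n. random_variable borel (U n)"
    and Q[measurable]: "\<And>n. random_variable borel (Q n)"
    and \<nu>: "real_distribution \<nu>" and conv: "weak_conv_m (\<lambda>n. distr M borel (U n)) \<nu>"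
    and int: "\<And>n. integrable M (U n)" and bound: "\<And>n. expectation (\<lambda>\<omega>. \<bar>U n \<omega>\<bar>) \<le> C"
    and Q_lim: "\<And>\<epsilon>. 0 < \<epsilon> \<Longrightarrow> (\<lambda>n. prob {\<omega> \<in> space M. \<epsilon> \<le> \<bar>Q n \<omega> - 1\<bar>}) \<longlonglongrightarrow> 0"
  shows "weak_conv_m (\<lambda>n. distr M borel (\<lambda>\<omega>. U n \<omega> * Q n \<omega>)) \<nu>"
proof (rule weak_conv_m_transfer[OF U _ \<nu> conv])
  fix t
  let ?e = "\<lambda>n. expectation (\<lambda>\<omega>. min 2 (\<bar>t\<bar> * \<bar>U n \<omega> * Q n \<omega> - U n \<omega>\<bar>))"
  have nonneg: "0 \<le> ?e n" for n
    by (intro Bochner_Integration.integral_nonneg) auto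
  have C: "0 \<le> C"
    by (rule order_trans[OF _ bound[of 0]]) (intro Bochner_Integration.integral_nonneg, auto)
  have split: "?e n \<le> 2 * prob {\<omega> \<in> space M. \<epsilon> \<le> \<bar>Q n \<omega> - 1\<bar>} + \<bar>t\<bar> * \<epsilon> * C"
    if "0 < \<epsilon>" for n \<epsilon>
  proof -
    let ?B = "{\<omega> \<in> space M. \<epsilon> \<le> \<bar>Q n \<omega> - 1\<bar>}"
    have [measurable]: "?B \<in> sets M" by measurable
    have pointwise: "min 2 (\<bar>t\<bar> * \<bar>U n \<omega> * Q n \<omega> - U n \<omega>\<bar>)
        \<le> 2 * indicator ?B \<omega> + \<bar>t\<bar> * \<epsilon> * \<bar>U n \<omega>\<bar>" if "\<omega> \<in> space M" for \<omega>
    proof (cases "\<omega> \<in> ?B")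
      case True
      have "0 \<le> \<bar>t\<bar> * \<epsilon> * \<bar>U n \<omega>\<bar>" using \<open>0 < \<epsilon>\<close> by simp
      with True show ?thesis by simp
    next
      case False
      then have "\<bar>Q n \<omega> - 1\<bar> \<le> \<epsilon>" using that by auto
      then have "\<bar>U n \<omega>\<bar> * \<bar>Q n \<omega> - 1\<bar> \<le> \<bar>U n \<omega>\<bar> * \<epsilon>"
        by (rule mult_left_mono) simp
      then have "\<bar>t\<bar> * (\<bar>U n \<omega>\<bar> * \<bar>Q n \<omega> - 1\<bar>) \<le> \<bar>t\<bar> * (\<bar>U n \<omega>\<bar> * \<epsilon>)"
        by (rule mult_left_mono) simp
      moreover have "\<bar>U n \<omega> * Q n \<omega> - U n \<omega>\<bar> = \<bar>U n \<omega>\<bar> * \<bar>Q n \<omega> - 1\<bar>"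
        by (simp add: abs_mult[symmetric] algebra_simps)
      ultimately show ?thesis using False by (simp add: mult_ac min.coboundedI2)
    qed
    have int_B: "integrable M (\<lambda>\<omega>. 2 * indicator ?B \<omega> :: real)"
      by (simp add: less_top[symmetric])
    have int_U: "integrable M (\<lambda>\<omega>. \<bar>t\<bar> * \<epsilon> * \<bar>U n \<omega>\<bar>)"
      using int[of n] by simp
    have "?e n \<le> expectation (\<lambda>\<omega>. 2 * indicator ?B \<omega> + \<bar>t\<bar> * \<epsilon> * \<bar>U n \<omega>\<bar>)"
    proof (rule integral_mono)
      show "integrable M (\<lambda>\<omega>. min 2 (\<bar>t\<bar> * \<bar>U n \<omega> * Q n \<omega> - U n \<omega>\<bar>))"
        by (rule integrable_const_bound[of _ 2]) auto
      show "integrable M (\<lambda>\<omega>. 2 * indicator ?B \<omega> + \<bar>t\<bar> * \<epsilon> * \<bar>U n \<omega>\<bar>)"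
        using int_B int_U by (rule Bochner_Integration.integrable_add)
    qed (rule pointwise)
    also have "\<dots> = 2 * prob ?B + \<bar>t\<bar> * \<epsilon> * expectation (\<lambda>\<omega>. \<bar>U n \<omega>\<bar>)"
      by (subst Bochner_Integration.integral_add[OF int_B int_U]) (simp add: Int_absorb2 subset_eq)
    also have "\<dots> \<le> 2 * prob ?B + \<bar>t\<bar> * \<epsilon> * C"
      using bound[of n] \<open>0 < \<epsilon>\<close> by (intro add_left_mono mult_left_mono) auto
    finally show ?thesis .
  qed
  show "?e \<longlonglongrightarrow> 0"
  proof (rule LIMSEQ_I)
    fix r :: real assume r: "0 < r"
    \<comment> \<open>The summand 1 keeps the denominator positive when \<open>t\<close> or \<open>C\<close> is 0.\<close>
    define \<epsilon> where "\<epsilon> = r / (2 * (\<bar>t\<bar> * C + 1))"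
    have pos: "0 < \<bar>t\<bar> * C + 1" using C by (simp add: add_nonneg_pos)
    then have \<epsilon>: "0 < \<epsilon>" using r by (simp add: \<epsilon>_def)
    have "\<bar>t\<bar> * \<epsilon> * C = (r / 2) * (\<bar>t\<bar> * C / (\<bar>t\<bar> * C + 1))" by (simp add: \<epsilon>_def)
    also have "\<dots> \<le> (r / 2) * 1" using pos r by (intro mult_left_mono) auto
    finally have small: "\<bar>t\<bar> * \<epsilon> * C \<le> r / 2" by simp
    have "eventually (\<lambda>n. prob {\<omega> \<in> space M. \<epsilon> \<le> \<bar>Q n \<omega> - 1\<bar>} < r / 4) sequentially"
      by (rule order_tendstoD(2)[OF Q_lim[OF \<epsilon>]]) (use r in simp)
    then have "eventually (\<lambda>n. norm (?e n - 0) < r) sequentially"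
    proof eventually_elim
      case (elim n)
      with split[OF \<epsilon>, of n] small nonneg[of n] show ?case by simp
    qed
    then show "\<exists>no. \<forall>n\<ge>no. norm (?e n - 0) < r"
      by (rule eventually_sequentially[THEN iffD1])
  qed
qed measurable

section \<open>Projecting the kernel under a diffuse law on the half-line\<close>

lemma (in real_distribution) interval_measure_cdf: "interval_measure (cdf M) = M"
proof (rule cdf_unique)
  show "real_distribution (interval_measure (cdf M))"
    by (intro real_distribution_interval_measure cdf_nondecreasing cdf_is_right_cont cdf_lim_at_bot
        cdf_lim_at_top_prob)
  show "cdf (interval_measure (cdf M)) = cdf M"
    by (intro cdf_interval_measure cdf_nondecreasing cdf_is_right_cont cdf_lim_at_bot)
qed (rule real_distribution_axioms)

locale diffuse_lifetime_law = real_distribution P for P :: "real measure" +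
  assumes positive: "AE x in P. 0 < x"
    and atomless: "\<And>x. measure P {x} = 0"
    and integrable_id: "integrable P (\<lambda>x. x)"
begin

definition mean :: real where
  "mean = (\<integral>x. x \<partial>P)"

definition mean_max :: real where
  "mean_max = (\<integral>z. max (fst z) (snd z) \<partial>(P \<Otimes>\<^sub>M P))"

text \<open>
The parameter \<open>\<delta>\<close> of the law, see \<open>delta_cdf\<close> below.
\<close>

definition ratio :: real where
  "ratio = mean_max / mean"

sublocale PP: pair_prob_space P P ..

lemma sets_PP [measurable_cong, simp]: "sets (P \<Otimes>\<^sub>M P) = sets (borel \<Otimes>\<^sub>M borel)"
  by (intro sets_pair_measure_cong) simp_all

lemma
  fixes f :: "real \<Rightarrow> real"
  assumes [measurable]: "f \<in> borel_measurable borel"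
  shows integrable_PP_fst: "integrable (P \<Otimes>\<^sub>M P) (\<lambda>z. f (fst z)) \<longleftrightarrow> integrable P f"
    and integrable_PP_snd: "integrable (P \<Otimes>\<^sub>M P) (\<lambda>z. f (snd z)) \<longleftrightarrow> integrable P f"
    and integral_PP_fst: "(\<integral>z. f (fst z) \<partial>(P \<Otimes>\<^sub>M P)) = (\<integral>x. f x \<partial>P)"
    and integral_PP_snd: "(\<integral>z. f (snd z) \<partial>(P \<Otimes>\<^sub>M P)) = (\<integral>x. f x \<partial>P)"
proof -
  have fst: "distr (P \<Otimes>\<^sub>M P) P fst = P"
    by (rule distr_pair_fst)
  have snd: "distr (P \<Otimes>\<^sub>M P) P snd = P"
  proof (rule measure_eqI)
    fix A assume "A \<in> sets (distr (P \<Otimes>\<^sub>M P) P snd)"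
    then have [measurable]: "A \<in> sets borel" by simp
    have "snd -` A \<inter> space (P \<Otimes>\<^sub>M P) = UNIV \<times> A" by (auto simp: space_pair_measure)
    then show "emeasure (distr (P \<Otimes>\<^sub>M P) P snd) A = emeasure P A"
      using emeasure_space_1 by (simp add: emeasure_distr emeasure_pair_measure_Times)
  qed simp
  show "integrable (P \<Otimes>\<^sub>M P) (\<lambda>z. f (fst z)) \<longleftrightarrow> integrable P f"
    by (subst (2) fst[symmetric], subst integrable_distr_eq) auto
  show "integrable (P \<Otimes>\<^sub>M P) (\<lambda>z. f (snd z)) \<longleftrightarrow> integrable P f"
    by (subst (2) snd[symmetric], subst integrable_distr_eq) auto
  show "(\<integral>z. f (fst z) \<partial>(P \<Otimes>\<^sub>M P)) = (\<integral>x. f x \<partial>P)"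
    by (subst (2) fst[symmetric], subst integral_distr) auto
  show "(\<integral>z. f (snd z) \<partial>(P \<Otimes>\<^sub>M P)) = (\<integral>x. f x \<partial>P)"
    by (subst (2) snd[symmetric], subst integral_distr) auto
qed

lemma AE_PP_positive: "AE z in P \<Otimes>\<^sub>M P. 0 < fst z \<and> 0 < snd z"
proof (rule PP.AE_pair_measure)
  show "AE x in P. AE y in P. 0 < fst (x, y) \<and> 0 < snd (x, y)"
    using positive
  proof eventually_elim
    case (elim x)
    show ?case using positive by eventually_elim (use elim in simp)
  qed
qed measurable

lemma mean_pos: "0 < mean"
proof -
  have "(\<integral>x. 0 \<partial>P) < (\<integral>x. x \<partial>P)"
    by (rule integral_less_AE_space) (use positive integrable_id emeasure_space_1 in simp_all)
  then show ?thesis by (simp add: mean_def)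
qed

lemma
  shows integrable_fst_PP: "integrable (P \<Otimes>\<^sub>M P) (\<lambda>z. fst z)"
    and integrable_snd_PP: "integrable (P \<Otimes>\<^sub>M P) (\<lambda>z. snd z)"
proof -
  have id: "(\<lambda>x. x) \<in> borel_measurable borel" by measurable
  show "integrable (P \<Otimes>\<^sub>M P) (\<lambda>z. fst z)"
    by (rule integrable_PP_fst[OF id, THEN iffD2, OF integrable_id])
  show "integrable (P \<Otimes>\<^sub>M P) (\<lambda>z. snd z)"
    by (rule integrable_PP_snd[OF id, THEN iffD2, OF integrable_id])
qed

lemma integrable_max_PP: "integrable (P \<Otimes>\<^sub>M P) (\<lambda>z. max (fst z) (snd z))"
  by (rule integrable_max[OF integrable_fst_PP integrable_snd_PP])

lemma integrable_max_const: "integrable P (\<lambda>y. max x y)"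
  by (rule integrable_max[OF integrable_const integrable_id])

lemma ratio_ge_1: "1 \<le> ratio"
proof -
  have "(\<integral>z. fst z \<partial>(P \<Otimes>\<^sub>M P)) \<le> mean_max"
    unfolding mean_max_def
    by (rule integral_mono[OF integrable_fst_PP integrable_max_PP]) simp
  then show ?thesis
    using mean_pos
    by (simp only: integral_PP_fst[of "\<lambda>x. x", simplified] ratio_def mean_def[symmetric]) simp
qed

text \<open>
Since \<open>2 \<mu> - E max(Z\<^sub>1, Z\<^sub>2) = E min(Z\<^sub>1, Z\<^sub>2)\<close>, and the minimum of two positive variables is positive.
\<close>

lemma ratio_less_2: "ratio < 2"
proof -
  have int: "integrable (P \<Otimes>\<^sub>M P) (\<lambda>z. fst z + snd z)"
    by (rule Bochner_Integration.integrable_add[OF integrable_fst_PP integrable_snd_PP])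
  have "mean_max < (\<integral>z. fst z + snd z \<partial>(P \<Otimes>\<^sub>M P))"
    unfolding mean_max_def
    by (rule PP.P.integral_less_AE_space[OF integrable_max_PP int])
       (use AE_PP_positive PP.P.emeasure_space_1 in \<open>auto elim!: eventually_mono\<close>)
  also have "\<dots> = 2 * mean"
    by (subst Bochner_Integration.integral_add[OF integrable_fst_PP integrable_snd_PP])
       (simp only: integral_PP_fst[of "\<lambda>x. x", simplified] integral_PP_snd[of "\<lambda>x. x", simplified] mean_def)
  finally show ?thesis
    using mean_pos by (simp add: ratio_def divide_less_eq)
qed

text \<open>
By Fubini, a typical section \<open>y \<mapsto> max u y - \<delta>/2 (u + y)\<close> of the kernel is square integrable. For
\<open>y > u\<close> it equals \<open>(1 - \<delta>/2) y - \<delta>/2 u\<close>, and its slope is positive because \<open>\<delta> < 2\<close>; so the section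
controls the tail of the law itself. Hence the moment condition on the kernel amounts to a finite second
moment, which makes all later integrability questions elementary.
\<close>

lemma square_integrable_id:
  assumes "integrable (P \<Otimes>\<^sub>M P)
    (\<lambda>z. (max (fst z) (snd z) - ratio / 2 * (fst z + snd z))\<^sup>2)"
  shows "integrable P (\<lambda>x. x\<^sup>2)"
proof -
  define K where "K x y = max x y - ratio / 2 * (x + y)" for x y :: real
  define a where "a = 1 - ratio / 2"
  have a: "0 < a" using ratio_less_2 by (simp add: a_def)
  have "AE x in P. integrable P (\<lambda>y. (K x y)\<^sup>2)"
    using PP.AE_integrable_fst'[OF assms] by (simp add: K_def)
  with positive have "AE x in P. 0 < x \<and> integrable P (\<lambda>y. (K x y)\<^sup>2)"
    by eventually_elim simp
  then obtain u where u: "0 < u" "integrable P (\<lambda>y. (K u y)\<^sup>2)"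
    using eventually_happens'[OF ae_filter_bot] by blast
  define b where "b = ratio / 2 * u"
  show ?thesis
  proof (rule Bochner_Integration.integrable_bound)
    show "integrable P (\<lambda>y. u\<^sup>2 + 2 / a\<^sup>2 * ((K u y)\<^sup>2 + b\<^sup>2))"
      using u by simp
    show "AE y in P. norm (y\<^sup>2) \<le> norm (u\<^sup>2 + 2 / a\<^sup>2 * ((K u y)\<^sup>2 + b\<^sup>2))"
      using positive
    proof eventually_elim
      case (elim y)
      have nonneg: "0 \<le> 2 / a\<^sup>2 * ((K u y)\<^sup>2 + b\<^sup>2)" by simp
      have "y\<^sup>2 \<le> u\<^sup>2 + 2 / a\<^sup>2 * ((K u y)\<^sup>2 + b\<^sup>2)"
      proof (cases "y \<le> u")
        case True
        then have "y\<^sup>2 \<le> u\<^sup>2" using elim by (intro power_mono) auto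
        then show ?thesis using nonneg by linarith
      next
        case False
        \<comment> \<open>Above \<open>u\<close> the section is affine in \<open>y\<close>.\<close>
        then have "a * y = K u y + b"
          by (simp add: K_def a_def b_def algebra_simps max_def)
        then have "(a * y)\<^sup>2 = (K u y + b)\<^sup>2" by simp
        also have "\<dots> \<le> 2 * ((K u y)\<^sup>2 + b\<^sup>2)"
          using sum_squares_bound[of "K u y" b] by (simp add: power2_sum)
        finally have "y\<^sup>2 \<le> 2 / a\<^sup>2 * ((K u y)\<^sup>2 + b\<^sup>2)"
          using a by (simp add: power_mult_distrib field_simps)
        moreover have "0 \<le> u\<^sup>2" by simp
        ultimately show ?thesis by linarith
      qed
      then show ?case using nonneg by simp
    qed
  qed simp
qed

lemma cdf_surj:
  assumes "0 < p" "p < 1"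
  obtains x where "cdf P x = p"
proof -
  obtain l where l: "cdf P l < p"
    using eventually_happens'[OF trivial_limit_at_bot_linorder order_tendstoD(2)[OF cdf_lim_at_bot]]
      assms by blast
  obtain u where u: "p < cdf P u"
    using eventually_happens'[OF trivial_limit_at_top_linorder order_tendstoD(1)[OF cdf_lim_at_top_prob]]
      assms by blast
  have "l \<le> u"
    using cdf_nondecreasing[of u l] l u by (cases "l \<le> u") auto
  then have "\<exists>x. l \<le> x \<and> x \<le> u \<and> cdf P x = p"
    using l u atomless by (intro IVT) (auto simp: isCont_cdf)
  then show ?thesis using that by blast
qed

text \<open>
An interval across which the distribution function grows has positive mass, so a property that holds
almost everywhere holds somewhere in it.
\<close>

lemma AE_meets_quantile_gap:
  assumes "AE x in P. Q x" "cdf P r < cdf P s"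
  obtains x where "r < x" "x \<le> s" "Q x"
proof -
  have "r < s" using cdf_nondecreasing[of s r] assms(2) by (cases "r < s") auto
  then have gap: "0 < measure P {r<..s}" using cdf_diff_eq assms(2) by fastforce
  have "\<exists>x. r < x \<and> x \<le> s \<and> Q x"
  proof (rule ccontr)
    assume none: "\<not> ?thesis"
    have "AE x in P. x \<notin> {r<..s}"
      using assms(1) by eventually_elim (use none in auto)
    then have "measure P {r<..s} = 0" by (subst prob_eq_0) auto
    then show False using gap by simp
  qed
  then show ?thesis using that by blast
qed

definition exp_max :: "real \<Rightarrow> real" where
  "exp_max x = (\<integral>y. max x y \<partial>P)"

text \<open>
The function of \<open>X\<close> in the definition of the asymptotic variance is thus, up to the linear term, the
conditional expectation of \<open>max(X\<^sub>1, X\<^sub>2)\<close> given one of its arguments.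
\<close>

lemma exp_max_eq: "exp_max x = x * cdf P x + (LINT t:{x<..}|P. t)"
proof -
  have "exp_max x = (\<integral>y. x * indicator {..x} y + indicator {x<..} y * y \<partial>P)"
    unfolding exp_max_def by (intro Bochner_Integration.integral_cong) (auto simp: indicator_def)
  also have "\<dots> = x * cdf P x + (\<integral>y. indicator {x<..} y * y \<partial>P)"
    by (subst Bochner_Integration.integral_add)
       (auto simp: cdf_def2 less_top[symmetric] intro!: integrable_real_mult_indicator integrable_id
         simp: mult.commute)
  finally show ?thesis by (simp add: set_lebesgue_integral_def)
qed

lemma exp_max_measurable [measurable]: "exp_max \<in> borel_measurable borel"
proof -
  have "(\<lambda>x. \<integral>y. max x y \<partial>P) \<in> borel_measurable borel" by measurable
  then show ?thesis by (simp add: exp_max_def[abs_def])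
qed

text \<open>
Convexity of \<open>exp_max\<close> in integrated form: its derivative is the distribution function, which is
monotone.
\<close>

lemma exp_max_increment:
  assumes "y < x"
  shows "(x - y) * cdf P y \<le> exp_max x - exp_max y"
    and "exp_max x - exp_max y \<le> (x - y) * cdf P x"
proof -
  have diff: "exp_max x - exp_max y = (\<integral>z. max x z - max y z \<partial>P)"
    unfolding exp_max_def by (subst Bochner_Integration.integral_diff) (auto intro: integrable_max_const)
  have cdf: "(x - y) * cdf P u = (\<integral>z. (x - y) * indicator {..u} z \<partial>P)" for u
    by (simp add: cdf_def2)
  have int: "integrable P (\<lambda>z. (x - y) * indicator {..u} z :: real)" for u
    by (simp add: less_top[symmetric])
  have int': "integrable P (\<lambda>z. max x z - max y z)"
    by (intro Bochner_Integration.integrable_diff integrable_max_const)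
  show "(x - y) * cdf P y \<le> exp_max x - exp_max y"
    unfolding diff cdf by (rule integral_mono[OF int int']) (use assms in \<open>auto simp: indicator_def\<close>)
  show "exp_max x - exp_max y \<le> (x - y) * cdf P x"
    unfolding diff cdf by (rule integral_mono[OF int' int]) (use assms in \<open>auto simp: indicator_def\<close>)
qed

lemma abs_exp_max_le: "\<bar>exp_max x\<bar> \<le> \<bar>x\<bar> + mean"
proof -
  have "\<bar>exp_max x\<bar> \<le> (\<integral>y. \<bar>max x y\<bar> \<partial>P)"
    unfolding exp_max_def by (rule integral_abs_bound)
  also have "\<dots> \<le> (\<integral>y. \<bar>x\<bar> + y \<partial>P)"
    using positive integrable_id integrable_max_const[of x]
    by (intro integral_mono_AE) (auto elim!: eventually_mono)
  also have "\<dots> = \<bar>x\<bar> + mean"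
    using integrable_id prob_space by (simp add: mean_def)
  finally show ?thesis .
qed

lemma integrable_exp_max: "integrable P exp_max"
proof (rule Bochner_Integration.integrable_bound)
  show "integrable P (\<lambda>x. \<bar>x\<bar> + mean)" using integrable_id by simp
  show "AE x in P. norm (exp_max x) \<le> norm (\<bar>x\<bar> + mean)"
  proof (rule AE_I2)
    fix x show "norm (exp_max x) \<le> norm (\<bar>x\<bar> + mean)"
      using abs_exp_max_le[of x] by simp
  qed
qed simp

lemma integral_exp_max: "(\<integral>x. exp_max x \<partial>P) = mean_max"
  using PP.integral_fst'[OF integrable_max_PP] by (simp add: exp_max_def mean_max_def)

text \<open>
The Hajek projection: the mean of the kernel \<open>max x Z - \<delta>/2 (x + Z)\<close> over \<open>Z\<close>, with \<open>x\<close> held fixed.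
\<close>

definition proj :: "real \<Rightarrow> real" where
  "proj x = exp_max x - ratio / 2 * x - ratio / 2 * mean"

lemma proj_measurable [measurable]: "proj \<in> borel_measurable borel"
  unfolding proj_def[abs_def] by measurable

lemma mean_max_eq: "mean_max = ratio * mean"
  using mean_pos by (simp add: ratio_def)

lemma integral_proj: "(\<integral>x. proj x \<partial>P) = 0"
proof -
  have "(\<integral>x. proj x \<partial>P) = mean_max - ratio / 2 * mean - ratio / 2 * mean"
    unfolding proj_def using integrable_exp_max integrable_id prob_space
    by (simp add: integral_exp_max mean_def)
  then show ?thesis by (simp add: mean_max_eq)
qed

text \<open>
If \<open>proj\<close> vanished almost everywhere, then its zeros \<open>y < x\<close> would give
\<open>(x - y) \<delta>/2 = exp_max x - exp_max y \<le> (x - y) F x\<close>, that is \<open>F x \<ge> \<delta>/2 \<ge> 1/2\<close>. But almost every point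
is a zero, so zeros can be found between the quantiles 1/8 and 1/4 and between 1/4 and 3/8, where
\<open>F\<close> is at most 3/8.
\<close>

lemma not_AE_proj_zero: "\<not> (AE x in P. proj x = 0)"
proof
  assume zero: "AE x in P. proj x = 0"
  obtain r where r: "cdf P r = 1/8" using cdf_surj[of "1/8"] by auto
  obtain s where s: "cdf P s = 1/4" using cdf_surj[of "1/4"] by auto
  obtain t where t: "cdf P t = 3/8" using cdf_surj[of "3/8"] by auto
  obtain y where y: "y \<le> s" "proj y = 0"
    using AE_meets_quantile_gap[OF zero, of r s] r s by auto
  obtain x where x: "s < x" "x \<le> t" "proj x = 0"
    using AE_meets_quantile_gap[OF zero, of s t] s t by auto
  have "(x - y) * (ratio / 2) = exp_max x - exp_max y"
    using x(3) y(2) by (simp add: proj_def field_simps)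
  also have "\<dots> \<le> (x - y) * cdf P x"
    using x y by (intro exp_max_increment) simp
  finally have "ratio / 2 \<le> cdf P x"
    using x y by (simp add: mult_le_cancel_left)
  also have "\<dots> \<le> 3/8" using cdf_nondecreasing[OF x(2)] t by simp
  finally show False using ratio_ge_1 by simp
qed

text \<open>
The degenerate part of the kernel: what is left after both projections are subtracted. The linear terms
of the kernel and of the projections cancel.
\<close>

definition resid :: "real \<times> real \<Rightarrow> real" where
  "resid z = max (fst z) (snd z) - exp_max (fst z) - exp_max (snd z) + mean_max"

lemma resid_measurable [measurable]: "resid \<in> borel_measurable (borel \<Otimes>\<^sub>M borel)"
  unfolding resid_def[abs_def] by measurable

lemma resid_commute: "resid (x, y) = resid (y, x)"
  by (simp add: resid_def max.commute)

lemma kernel_decomposition: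
  "max x y - ratio / 2 * (x + y) = resid (x, y) + proj x + proj y"
  by (simp add: resid_def proj_def mean_max_eq field_simps)

text \<open>
Degeneracy, the source of all orthogonality below.
\<close>

lemma integral_resid: "(\<integral>y. resid (x, y) \<partial>P) = 0"
  unfolding resid_def using integrable_max_const[of x] integrable_exp_max prob_space
  by (simp add: integral_exp_max exp_max_def[of x, symmetric])

lemma delta_cdf: "delta (cdf P) = ratio"
  by (simp add: delta_def df_mean_max_def df_mean_def interval_measure_cdf ratio_def mean_max_def
      mean_def)

lemma asymp_var_cdf: "asymp_var (cdf P) = 4 / mean\<^sup>2 * (\<integral>x. (proj x)\<^sup>2 \<partial>P)"
proof -
  let ?f = "\<lambda>x. x * cdf P x + (LINT t:{x<..}|P. t) - ratio / 2 * x"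
  have f: "?f x = proj x + ratio / 2 * mean" for x
    by (simp add: proj_def exp_max_eq)
  have "integrable P proj"
    unfolding proj_def[abs_def] using integrable_exp_max integrable_id by simp
  then have expectation_f: "expectation ?f = ratio / 2 * mean"
    unfolding f using integral_proj prob_space by simp
  have "variance ?f = (\<integral>x. (proj x)\<^sup>2 \<partial>P)"
    unfolding expectation_f unfolding f by simp
  then show ?thesis
    by (simp add: asymp_var_def interval_measure_cdf delta_cdf df_mean_def mean_def)
qed

end

locale square_integrable_lifetime_law = diffuse_lifetime_law +
  assumes integrable_square: "integrable P (\<lambda>x. x\<^sup>2)"
begin

lemma integrable_exp_max_square: "integrable P (\<lambda>x. (exp_max x)\<^sup>2)"
proof (rule Bochner_Integration.integrable_bound)
  show "integrable P (\<lambda>x. 2 * (x\<^sup>2 + mean\<^sup>2))" using integrable_square by simp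
  show "AE x in P. norm ((exp_max x)\<^sup>2) \<le> norm (2 * (x\<^sup>2 + mean\<^sup>2))"
  proof (rule AE_I2)
    fix x
    have "\<bar>exp_max x\<bar>\<^sup>2 \<le> (\<bar>x\<bar> + mean)\<^sup>2"
      by (intro power_mono abs_exp_max_le) simp
    also have "\<dots> \<le> 2 * (x\<^sup>2 + mean\<^sup>2)"
      using sum_squares_bound[of "\<bar>x\<bar>" mean] by (simp add: power2_sum)
    finally show "norm ((exp_max x)\<^sup>2) \<le> norm (2 * (x\<^sup>2 + mean\<^sup>2))" by simp
  qed
qed simp

lemma integrable_proj_square: "integrable P (\<lambda>x. (proj x)\<^sup>2)"
proof (rule Bochner_Integration.integrable_bound)
  show "integrable P (\<lambda>x. 3 * ((exp_max x)\<^sup>2 + (ratio / 2 * x)\<^sup>2 + (ratio / 2 * mean)\<^sup>2))"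
    using integrable_exp_max_square integrable_square by (simp add: power_mult_distrib power_divide)
  show "AE x in P. norm ((proj x)\<^sup>2)
      \<le> norm (3 * ((exp_max x)\<^sup>2 + (ratio / 2 * x)\<^sup>2 + (ratio / 2 * mean)\<^sup>2))"
  proof (rule AE_I2)
    fix x
    have "(a - b - c)\<^sup>2 \<le> 3 * (a\<^sup>2 + b\<^sup>2 + c\<^sup>2)" for a b c :: real
    proof -
      have "3 * (a\<^sup>2 + b\<^sup>2 + c\<^sup>2) - (a - b - c)\<^sup>2 = (a + b)\<^sup>2 + (a + c)\<^sup>2 + (b - c)\<^sup>2"
        by (simp add: power2_eq_square algebra_simps)
      then show ?thesis by (smt (verit) zero_le_power2)
    qed
    then show "norm ((proj x)\<^sup>2)
        \<le> norm (3 * ((exp_max x)\<^sup>2 + (ratio / 2 * x)\<^sup>2 + (ratio / 2 * mean)\<^sup>2))"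
      by (simp add: proj_def)
  qed
qed simp

lemma proj_variance_pos: "0 < (\<integral>x. (proj x)\<^sup>2 \<partial>P)"
proof -
  have "(\<integral>x. (proj x)\<^sup>2 \<partial>P) \<noteq> 0"
    using not_AE_proj_zero integral_nonneg_eq_0_iff_AE[OF integrable_proj_square] by simp
  moreover have "0 \<le> (\<integral>x. (proj x)\<^sup>2 \<partial>P)"
    by (intro Bochner_Integration.integral_nonneg) simp
  ultimately show ?thesis by linarith
qed

lemma asymp_var_pos: "0 < asymp_var (cdf P)"
  using proj_variance_pos mean_pos by (simp add: asymp_var_cdf)

lemma integrable_resid_square: "integrable (P \<Otimes>\<^sub>M P) (\<lambda>z. (resid z)\<^sup>2)"
proof (rule Bochner_Integration.integrable_bound)
  let ?b = "\<lambda>z. 4 * (((fst z)\<^sup>2 + (snd z)\<^sup>2) + (exp_max (fst z))\<^sup>2 + (exp_max (snd z))\<^sup>2 + mean_max\<^sup>2)"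
  show "integrable (P \<Otimes>\<^sub>M P) ?b"
    using integrable_exp_max_square integrable_square
      integrable_PP_fst[of "\<lambda>x. x\<^sup>2"] integrable_PP_snd[of "\<lambda>x. x\<^sup>2"]
      integrable_PP_fst[of "\<lambda>x. (exp_max x)\<^sup>2"] integrable_PP_snd[of "\<lambda>x. (exp_max x)\<^sup>2"] by simp
  show "AE z in P \<Otimes>\<^sub>M P. norm ((resid z)\<^sup>2) \<le> norm (?b z)"
  proof (rule AE_I2)
    fix z :: "real \<times> real"
    have four: "(a - b - c + d)\<^sup>2 \<le> 4 * (a\<^sup>2 + b\<^sup>2 + c\<^sup>2 + d\<^sup>2)" for a b c d :: real
    proof -
      have "4 * (a\<^sup>2 + b\<^sup>2 + c\<^sup>2 + d\<^sup>2) - (a - b - c + d)\<^sup>2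
          = (a + b)\<^sup>2 + (a + c)\<^sup>2 + (a - d)\<^sup>2 + (b - c)\<^sup>2 + (b + d)\<^sup>2 + (c + d)\<^sup>2"
        by (simp add: power2_eq_square algebra_simps)
      then show ?thesis by (smt (verit) zero_le_power2)
    qed
    have "(max (fst z) (snd z))\<^sup>2 \<le> (fst z)\<^sup>2 + (snd z)\<^sup>2" by (simp add: max_def)
    then show "norm ((resid z)\<^sup>2) \<le> norm (?b z)"
      using four[of "max (fst z) (snd z)" "exp_max (fst z)" "exp_max (snd z)" mean_max]
      by (simp add: resid_def)
  qed
qed simp

end

section \<open>Second moments of sums of orthogonal variables\<close>

lemma (in prob_space) integrable_mult_of_squares:
  fixes f g :: "'a \<Rightarrow> real"
  assumes [measurable]: "random_variable borel f" "random_variable borel g"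
    and "integrable M (\<lambda>\<omega>. (f \<omega>)\<^sup>2)" "integrable M (\<lambda>\<omega>. (g \<omega>)\<^sup>2)"
  shows "integrable M (\<lambda>\<omega>. f \<omega> * g \<omega>)"
proof (rule Bochner_Integration.integrable_bound)
  show "integrable M (\<lambda>\<omega>. (f \<omega>)\<^sup>2 + (g \<omega>)\<^sup>2)"
    using assms(3,4) by (rule Bochner_Integration.integrable_add)
  show "AE \<omega> in M. norm (f \<omega> * g \<omega>) \<le> norm ((f \<omega>)\<^sup>2 + (g \<omega>)\<^sup>2)"
  proof (rule AE_I2)
    fix \<omega>
    have "2 * \<bar>f \<omega> * g \<omega>\<bar> \<le> (f \<omega>)\<^sup>2 + (g \<omega>)\<^sup>2"
      using sum_squares_bound[of "\<bar>f \<omega>\<bar>" "\<bar>g \<omega>\<bar>"] by (simp add: abs_mult mult.assoc)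
    then show "norm (f \<omega> * g \<omega>) \<le> norm ((f \<omega>)\<^sup>2 + (g \<omega>)\<^sup>2)" by simp
  qed
qed measurable

lemma (in prob_space) expectation_abs_le_sqrt:
  fixes Z :: "'a \<Rightarrow> real"
  assumes [measurable]: "random_variable borel Z" and sq: "integrable M (\<lambda>\<omega>. (Z \<omega>)\<^sup>2)"
    and bound: "expectation (\<lambda>\<omega>. (Z \<omega>)\<^sup>2) \<le> c"
  shows "expectation (\<lambda>\<omega>. \<bar>Z \<omega>\<bar>) \<le> sqrt c"
proof -
  have "integrable M Z"
    by (rule square_integrable_imp_integrable[OF _ sq]) measurable
  then have "variance (\<lambda>\<omega>. \<bar>Z \<omega>\<bar>) = expectation (\<lambda>\<omega>. \<bar>Z \<omega>\<bar>\<^sup>2) - (expectation (\<lambda>\<omega>. \<bar>Z \<omega>\<bar>))\<^sup>2"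
    using sq by (intro variance_eq) simp_all
  then have "(expectation (\<lambda>\<omega>. \<bar>Z \<omega>\<bar>))\<^sup>2 \<le> c"
    using variance_positive[of "\<lambda>\<omega>. \<bar>Z \<omega>\<bar>"] bound by simp
  then show ?thesis by (rule real_le_rsqrt)
qed

text \<open>
When each variable is orthogonal to all but \<open>d\<close> of the family (itself included), only \<open>d card I\<close> of the
\<open>(card I)\<^sup>2\<close> terms of the expanded square survive, and each is at most \<open>c\<close> because \<open>2 a b \<le> a\<^sup>2 + b\<^sup>2\<close>.
The case \<open>d = 1\<close> is used for sums of centered independent variables, and \<open>d = 2\<close> for the degenerate
sum over ordered pairs, where \<open>(i, j)\<close> and \<open>(j, i)\<close> carry the same variable.
\<close>

lemma (in prob_space)
  fixes Z :: "'b \<Rightarrow> 'a \<Rightarrow> real"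
  assumes fin: "finite I"
    and rv[measurable]: "\<And>p. p \<in> I \<Longrightarrow> random_variable borel (Z p)"
    and sq: "\<And>p. p \<in> I \<Longrightarrow> integrable M (\<lambda>\<omega>. (Z p \<omega>)\<^sup>2)"
    and bound: "\<And>p. p \<in> I \<Longrightarrow> expectation (\<lambda>\<omega>. (Z p \<omega>)\<^sup>2) \<le> c"
    and degree: "\<And>p. p \<in> I \<Longrightarrow> card {q \<in> I. expectation (\<lambda>\<omega>. Z p \<omega> * Z q \<omega>) \<noteq> 0} \<le> d"
  shows integrable_square_sum: "integrable M (\<lambda>\<omega>. (\<Sum>p\<in>I. Z p \<omega>)\<^sup>2)"
    and second_moment_sum_le:
      "expectation (\<lambda>\<omega>. (\<Sum>p\<in>I. Z p \<omega>)\<^sup>2) \<le> real (card I) * real d * c"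
proof -
  have expand: "(\<Sum>p\<in>I. Z p \<omega>)\<^sup>2 = (\<Sum>p\<in>I. \<Sum>q\<in>I. Z p \<omega> * Z q \<omega>)" for \<omega>
    by (simp add: power2_eq_square sum_product)
  have int: "integrable M (\<lambda>\<omega>. Z p \<omega> * Z q \<omega>)" if "p \<in> I" "q \<in> I" for p q
    using that by (intro integrable_mult_of_squares rv sq)
  show "integrable M (\<lambda>\<omega>. (\<Sum>p\<in>I. Z p \<omega>)\<^sup>2)"
    unfolding expand by (intro Bochner_Integration.integrable_sum int)
  have le_c: "expectation (\<lambda>\<omega>. Z p \<omega> * Z q \<omega>) \<le> c" if "p \<in> I" "q \<in> I" for p q
  proof -
    have "expectation (\<lambda>\<omega>. Z p \<omega> * Z q \<omega>) \<le> expectation (\<lambda>\<omega>. ((Z p \<omega>)\<^sup>2 + (Z q \<omega>)\<^sup>2) / 2)"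
    proof (rule integral_mono)
      show "Z p \<omega> * Z q \<omega> \<le> ((Z p \<omega>)\<^sup>2 + (Z q \<omega>)\<^sup>2) / 2" for \<omega>
        using sum_squares_bound[of "Z p \<omega>" "Z q \<omega>"] by simp
    qed (use that sq int in auto)
    also have "\<dots> = (expectation (\<lambda>\<omega>. (Z p \<omega>)\<^sup>2) + expectation (\<lambda>\<omega>. (Z q \<omega>)\<^sup>2)) / 2"
      using that sq by simp
    also have "\<dots> \<le> c" using bound[OF that(1)] bound[OF that(2)] by simp
    finally show ?thesis .
  qed
  have "expectation (\<lambda>\<omega>. (\<Sum>p\<in>I. Z p \<omega>)\<^sup>2) = (\<Sum>p\<in>I. \<Sum>q\<in>I. expectation (\<lambda>\<omega>. Z p \<omega> * Z q \<omega>))"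
    unfolding expand using int by simp
  also have "\<dots> \<le> (\<Sum>p\<in>I. real d * c)"
  proof (rule sum_mono)
    fix p assume p: "p \<in> I"
    let ?N = "{q \<in> I. expectation (\<lambda>\<omega>. Z p \<omega> * Z q \<omega>) \<noteq> 0}"
    have "0 \<le> expectation (\<lambda>\<omega>. (Z p \<omega>)\<^sup>2)" by (rule Bochner_Integration.integral_nonneg) simp
    then have c: "0 \<le> c" using bound[OF p] by linarith
    have "(\<Sum>q\<in>I. expectation (\<lambda>\<omega>. Z p \<omega> * Z q \<omega>)) = (\<Sum>q\<in>?N. expectation (\<lambda>\<omega>. Z p \<omega> * Z q \<omega>))"
      using fin by (intro sum.mono_neutral_right) auto
    also have "\<dots> \<le> (\<Sum>q\<in>?N. c)" by (intro sum_mono le_c p) auto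
    also have "\<dots> \<le> real d * c" using degree[OF p] c by (simp add: mult_right_mono)
    finally show "(\<Sum>q\<in>I. expectation (\<lambda>\<omega>. Z p \<omega> * Z q \<omega>)) \<le> real d * c" .
  qed
  also have "\<dots> = real (card I) * real d * c" by simp
  finally show "expectation (\<lambda>\<omega>. (\<Sum>p\<in>I. Z p \<omega>)\<^sup>2) \<le> real (card I) * real d * c" .
qed

section \<open>Decomposition of the estimator\<close>

definition offdiag :: "nat \<Rightarrow> (nat \<times> nat) set" where
  "offdiag n = {(i, j). i < n \<and> j < n \<and> i \<noteq> j}"

lemma offdiag_Sigma: "offdiag n = Sigma {..<n} (\<lambda>i. {..<n} - {i})"
  by (auto simp: offdiag_def)

lemma finite_offdiag [simp]: "finite (offdiag n)"
  by (simp add: offdiag_Sigma)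

lemma card_offdiag: "card (offdiag n) = n * (n - 1)"
  by (simp add: offdiag_Sigma)

lemma sum_offdiag_fst: "(\<Sum>p\<in>offdiag n. a (fst p)) = real (n - 1) * (\<Sum>i<n. a i :: real)"
proof -
  have "(\<Sum>p\<in>offdiag n. a (fst p)) = (\<Sum>i<n. \<Sum>j\<in>{..<n} - {i}. a i)"
    unfolding offdiag_Sigma by (subst sum.Sigma) (auto intro!: sum.cong)
  then show ?thesis by (simp add: sum_distrib_left)
qed

lemma sum_offdiag_snd: "(\<Sum>p\<in>offdiag n. a (snd p)) = real (n - 1) * (\<Sum>i<n. a i :: real)"
proof -
  have "(\<Sum>p\<in>offdiag n. a (snd p)) = (\<Sum>p\<in>offdiag n. a (fst p))"
    by (rule sum.reindex_bij_witness[of _ prod.swap prod.swap]) (auto simp: offdiag_def)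
  then show ?thesis by (simp add: sum_offdiag_fst)
qed

lemma delta_hat_eq:
  "delta_hat n x = (\<Sum>p\<in>offdiag n. max (x (fst p)) (x (snd p)))
    / (real n * (real n - 1) * sample_mean n x)"
  by (simp add: delta_hat_def offdiag_def case_prod_beta)

lemma delta_hat_measurable [measurable]: "delta_hat n \<in> borel_measurable (Pi\<^sub>M UNIV (\<lambda>_. borel))"
proof -
  have "(\<lambda>x :: nat \<Rightarrow> real. (\<Sum>p\<in>offdiag n. max (x (fst p)) (x (snd p)))
      / (real n * (real n - 1) * ((1 / real n) * (\<Sum>i<n. x i)))) \<in> borel_measurable (Pi\<^sub>M UNIV (\<lambda>_. borel))"
    by measurable
  then show ?thesis
    by (simp add: delta_hat_eq[abs_def] sample_mean_def)
qed

context diffuse_lifetime_law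
begin

text \<open>
The error of the estimator is a U-statistic with kernel \<open>max x y - \<delta>/2 (x + y)\<close> divided by the sample
mean; the kernel splits into the two projections, each index occurring in \<open>n - 1\<close> pairs on either side,
and the degenerate rest.
\<close>

lemma delta_hat_decomposition:
  assumes n: "2 \<le> n" and nz: "sample_mean n x \<noteq> 0"
  shows "delta_hat n x - ratio =
    (2 / real n * (\<Sum>i<n. proj (x i))
      + (\<Sum>p\<in>offdiag n. resid (x (fst p), x (snd p))) / (real n * (real n - 1))) / sample_mean n x"
proof -
  let ?N = "real n * (real n - 1)"
  have N: "0 < ?N" using n by simp
  let ?R = "\<Sum>p\<in>offdiag n. resid (x (fst p), x (snd p))"
  let ?S = "\<Sum>i<n. x i" let ?G = "\<Sum>i<n. proj (x i)"
  define a where "a i = proj (x i) + ratio / 2 * x i" for i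
  have mx: "max (x i) (x j) = resid (x i, x j) + a i + a j" for i j
    using kernel_decomposition[of "x i" "x j"] by (simp add: a_def field_simps)
  have "(\<Sum>p\<in>offdiag n. max (x (fst p)) (x (snd p))) = ?R + 2 * (real n - 1) * (\<Sum>i<n. a i)"
    unfolding mx sum.distrib using n
    by (simp add: sum_offdiag_fst[of a] sum_offdiag_snd[of a] of_nat_diff algebra_simps)
  also have "\<dots> = ?R + 2 * (real n - 1) * ?G + ratio * ?N * sample_mean n x"
  proof -
    have "(\<Sum>i<n. a i) = ?G + ratio / 2 * ?S"
      by (simp add: a_def sum.distrib sum_distrib_left)
    moreover have "?S = real n * sample_mean n x"
      using n by (simp add: sample_mean_def)
    ultimately show ?thesis by (simp add: field_simps)
  qed
  finally have "delta_hat n x = (?R + 2 * (real n - 1) * ?G + ratio * ?N * sample_mean n x) / (?N * sample_mean n x)"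
    by (simp add: delta_hat_eq)
  also have "\<dots> = (?R / ?N + 2 * (real n - 1) * ?G / ?N) / sample_mean n x + ratio"
    using n nz by (simp add: add_divide_distrib)
  also have "2 * (real n - 1) * ?G / ?N = 2 / real n * ?G"
    using n by (simp add: field_simps)
  finally show ?thesis by simp
qed

end

section \<open>Independent samples and orthogonality\<close>

locale iid_sample = prob_space M + law: real_distribution P
  for M :: "'a measure" and P :: "real measure" +
  fixes X :: "nat \<Rightarrow> 'a \<Rightarrow> real"
  assumes indep: "indep_vars (\<lambda>_. borel) X UNIV"
    and distr_X: "\<And>i. distr M borel (X i) = P"
begin

lemma X_measurable [measurable]: "X i \<in> borel_measurable M"
  using indep unfolding indep_vars_def2 by simp

lemma
  fixes f :: "real \<Rightarrow> real"
  assumes [measurable]: "f \<in> borel_measurable borel"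
  shows integrable_X: "integrable M (\<lambda>\<omega>. f (X i \<omega>)) \<longleftrightarrow> integrable P f"
    and expectation_X: "expectation (\<lambda>\<omega>. f (X i \<omega>)) = (\<integral>x. f x \<partial>P)"
  by (simp_all add: distr_X[of i, symmetric] integrable_distr_eq integral_distr)

text \<open>
A variable outside of a block of the sample is independent of the block. Since \<open>indep_var\<close>
relates variables with values in one type, the single variable is first viewed as a block with one index.
\<close>

lemma distr_X_tuple:
  assumes "j \<notin> K"
  shows "distr M (Pi\<^sub>M K (\<lambda>_. borel) \<Otimes>\<^sub>M borel) (\<lambda>\<omega>. (\<lambda>i\<in>K. X i \<omega>, X j \<omega>))
    = distr M (Pi\<^sub>M K (\<lambda>_. borel)) (\<lambda>\<omega>. \<lambda>i\<in>K. X i \<omega>) \<Otimes>\<^sub>M P" (is "_ = ?A \<Otimes>\<^sub>M P")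
proof -
  let ?S = "\<lambda>I :: nat set. Pi\<^sub>M I (\<lambda>_. borel :: real measure)"
  let ?X = "\<lambda>I \<omega>. \<lambda>i\<in>I. X i \<omega>"
  have [measurable]: "?X I \<in> measurable M (?S I)" for I by measurable
  have [measurable]: "(\<lambda>a. a j) \<in> borel_measurable (?S {j})"
    by (intro measurable_component_singleton) simp
  interpret A: prob_space ?A by (rule prob_space_distr) measurable
  interpret B: prob_space "distr M (?S {j}) (?X {j})" by (rule prob_space_distr) measurable
  have P_eq: "distr (distr M (?S {j}) (?X {j})) borel (\<lambda>a. a j) = P"
    by (subst distr_distr) (auto simp: comp_def distr_X)
  have joint: "distr M (?S K \<Otimes>\<^sub>M ?S {j}) (\<lambda>\<omega>. (?X K \<omega>, ?X {j} \<omega>)) = ?A \<Otimes>\<^sub>M distr M (?S {j}) (?X {j})"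
    using indep_var_restrict[OF indep, of K "{j}"] assms
    unfolding indep_var_distribution_eq by simp
  have "distr M (?S K \<Otimes>\<^sub>M borel) (\<lambda>\<omega>. (?X K \<omega>, X j \<omega>))
      = distr (distr M (?S K \<Otimes>\<^sub>M ?S {j}) (\<lambda>\<omega>. (?X K \<omega>, ?X {j} \<omega>))) (?S K \<Otimes>\<^sub>M borel) (\<lambda>(a, b). (a, b j))"
    by (subst distr_distr) (auto simp: comp_def)
  also have "\<dots> = distr (?A \<Otimes>\<^sub>M distr M (?S {j}) (?X {j})) (?S K \<Otimes>\<^sub>M borel) (\<lambda>(a, b). (a, b j))"
    by (simp only: joint)
  also have "\<dots> = distr ?A (?S K) (\<lambda>a. a) \<Otimes>\<^sub>M distr (distr M (?S {j}) (?X {j})) borel (\<lambda>a. a j)"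
    by (rule pair_measure_distr[symmetric])
       (auto simp: P_eq intro: law.sigma_finite_measure_axioms)
  also have "\<dots> = ?A \<Otimes>\<^sub>M P"
    by (subst distr_id2) (simp_all add: P_eq)
  finally show ?thesis .
qed

text \<open>
Integrating out one observation first, with the others held fixed.
\<close>

lemma expectation_zero_by_independence:
  fixes f :: "(nat \<Rightarrow> real) \<times> real \<Rightarrow> real"
  assumes j: "j \<notin> K"
    and f[measurable]: "f \<in> borel_measurable (Pi\<^sub>M K (\<lambda>_. borel) \<Otimes>\<^sub>M borel)"
    and int: "integrable M (\<lambda>\<omega>. f (\<lambda>i\<in>K. X i \<omega>, X j \<omega>))"
    and zero: "\<And>a. (\<integral>y. f (a, y) \<partial>P) = 0"
  shows "expectation (\<lambda>\<omega>. f (\<lambda>i\<in>K. X i \<omega>, X j \<omega>)) = 0"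
proof -
  let ?A = "\<lambda>\<omega>. \<lambda>i\<in>K. X i \<omega>" and ?S = "Pi\<^sub>M K (\<lambda>_. borel) :: (nat \<Rightarrow> real) measure"
  have A[measurable]: "?A \<in> measurable M ?S" by measurable
  interpret A: prob_space "distr M ?S ?A" by (rule prob_space_distr) measurable
  interpret AP: pair_prob_space "distr M ?S ?A" P ..
  note joint = distr_X_tuple[OF j]
  have int': "integrable (distr M ?S ?A \<Otimes>\<^sub>M P) f"
    unfolding joint[symmetric] using int by (subst integrable_distr_eq) auto
  have "expectation (\<lambda>\<omega>. f (?A \<omega>, X j \<omega>)) = (\<integral>z. f z \<partial>(distr M ?S ?A \<Otimes>\<^sub>M P))"
    unfolding joint[symmetric] by (subst integral_distr) auto
  also have "\<dots> = (\<integral>a. (\<integral>y. f (a, y) \<partial>P) \<partial>distr M ?S ?A)"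
    by (rule AP.integral_fst'[OF int', symmetric])
  finally show ?thesis by (simp add: zero)
qed

lemma distr_X_pair:
  assumes "i \<noteq> j"
  shows "distr M (borel \<Otimes>\<^sub>M borel) (\<lambda>\<omega>. (X i \<omega>, X j \<omega>)) = P \<Otimes>\<^sub>M P"
proof -
  have "indep_var borel ((\<lambda>a. a i) \<circ> (\<lambda>\<omega>. \<lambda>k\<in>{i}. X k \<omega>)) borel ((\<lambda>a. a j) \<circ> (\<lambda>\<omega>. \<lambda>k\<in>{j}. X k \<omega>))"
    by (rule indep_var_compose[OF indep_var_restrict[OF indep, of "{i}" "{j}"]])
       (use assms in \<open>auto intro!: measurable_component_singleton\<close>)
  then show ?thesis
    unfolding indep_var_distribution_eq by (simp add: comp_def distr_X)
qed

lemma
  fixes h :: "real \<Rightarrow> real"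
  assumes [measurable]: "h \<in> borel_measurable borel"
    and centered: "(\<integral>x. h x \<partial>P) = 0" and sq: "integrable P (\<lambda>x. (h x)\<^sup>2)"
  shows integrable_centered_sum: "integrable M (\<lambda>\<omega>. (\<Sum>i<n. h (X i \<omega>))\<^sup>2)"
    and second_moment_centered_sum:
      "expectation (\<lambda>\<omega>. (\<Sum>i<n. h (X i \<omega>))\<^sup>2) \<le> real n * (\<integral>x. (h x)\<^sup>2 \<partial>P)"
proof -
  have sq_X: "integrable M (\<lambda>\<omega>. (h (X i \<omega>))\<^sup>2)" for i
    using integrable_X[of "\<lambda>x. (h x)\<^sup>2" i] sq by simp
  have sq_eq: "expectation (\<lambda>\<omega>. (h (X i \<omega>))\<^sup>2) = (\<integral>x. (h x)\<^sup>2 \<partial>P)" for i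
    by (rule expectation_X) measurable
  have orthogonal: "expectation (\<lambda>\<omega>. h (X i \<omega>) * h (X j \<omega>)) = 0" if "i \<noteq> j" for i j
  proof -
    let ?f = "\<lambda>z :: (nat \<Rightarrow> real) \<times> real. h (fst z i) * h (snd z)"
    have "expectation (\<lambda>\<omega>. ?f (\<lambda>k\<in>{i}. X k \<omega>, X j \<omega>)) = 0"
    proof (rule expectation_zero_by_independence)
      show "?f \<in> borel_measurable (Pi\<^sub>M {i} (\<lambda>_. borel) \<Otimes>\<^sub>M borel)" by measurable
      show "integrable M (\<lambda>\<omega>. ?f (\<lambda>k\<in>{i}. X k \<omega>, X j \<omega>))"
        using sq_X by (auto intro!: integrable_mult_of_squares)
      show "(\<integral>y. ?f (a, y) \<partial>P) = 0" for a
        by (simp add: centered)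
    qed (use that in auto)
    then show ?thesis by simp
  qed
  have degree: "card {j \<in> {..<n}. expectation (\<lambda>\<omega>. h (X i \<omega>) * h (X j \<omega>)) \<noteq> 0} \<le> 1" for i
  proof -
    have "{j \<in> {..<n}. expectation (\<lambda>\<omega>. h (X i \<omega>) * h (X j \<omega>)) \<noteq> 0} \<subseteq> {i}"
      using orthogonal[of i] by force
    from card_mono[OF _ this] show ?thesis by simp
  qed
  have rv: "random_variable borel (\<lambda>\<omega>. h (X i \<omega>))" for i by measurable
  show "integrable M (\<lambda>\<omega>. (\<Sum>i<n. h (X i \<omega>))\<^sup>2)"
    by (rule integrable_square_sum[where d=1 and c="\<integral>x. (h x)\<^sup>2 \<partial>P"])
       (use rv degree sq_X sq_eq in auto)
  have "expectation (\<lambda>\<omega>. (\<Sum>i<n. h (X i \<omega>))\<^sup>2)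
      \<le> real (card {..<n}) * real 1 * (\<integral>x. (h x)\<^sup>2 \<partial>P)"
    by (rule second_moment_sum_le) (use rv degree sq_X sq_eq in auto)
  then show "expectation (\<lambda>\<omega>. (\<Sum>i<n. h (X i \<omega>))\<^sup>2) \<le> real n * (\<integral>x. (h x)\<^sup>2 \<partial>P)"
    by simp
qed


end

locale iid_lifetimes = iid_sample M P X + law: square_integrable_lifetime_law P
  for M :: "'a measure" and P :: "real measure" and X :: "nat \<Rightarrow> 'a \<Rightarrow> real"
begin

lemma
  assumes "i \<noteq> j"
  shows integrable_resid_X: "integrable M (\<lambda>\<omega>. (law.resid (X i \<omega>, X j \<omega>))\<^sup>2)"
    and expectation_resid_X:
      "expectation (\<lambda>\<omega>. (law.resid (X i \<omega>, X j \<omega>))\<^sup>2) = (\<integral>z. (law.resid z)\<^sup>2 \<partial>(P \<Otimes>\<^sub>M P))"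
proof -
  show "integrable M (\<lambda>\<omega>. (law.resid (X i \<omega>, X j \<omega>))\<^sup>2)"
    using law.integrable_resid_square unfolding distr_X_pair[OF assms, symmetric]
    by (subst (asm) integrable_distr_eq) auto
  show "expectation (\<lambda>\<omega>. (law.resid (X i \<omega>, X j \<omega>))\<^sup>2) = (\<integral>z. (law.resid z)\<^sup>2 \<partial>(P \<Otimes>\<^sub>M P))"
    unfolding distr_X_pair[OF assms, symmetric] by (subst integral_distr) auto
qed

text \<open>
The index \<open>j\<close> occurs in one factor only, and integrating out that observation kills the product.
\<close>

lemma resid_orthogonal_new_index:
  assumes "i \<noteq> j" "k \<noteq> l" "j \<noteq> k" "j \<noteq> l"
  shows "expectation (\<lambda>\<omega>. law.resid (X i \<omega>, X j \<omega>) * law.resid (X k \<omega>, X l \<omega>)) = 0"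
proof -
  let ?K = "{i, k, l}"
  let ?f = "\<lambda>z :: (nat \<Rightarrow> real) \<times> real. law.resid (fst z i, snd z) * law.resid (fst z k, fst z l)"
  have "expectation (\<lambda>\<omega>. ?f (\<lambda>i\<in>?K. X i \<omega>, X j \<omega>)) = 0"
  proof (rule expectation_zero_by_independence)
    show "?f \<in> borel_measurable (Pi\<^sub>M ?K (\<lambda>_. borel) \<Otimes>\<^sub>M borel)" by measurable
    show "integrable M (\<lambda>\<omega>. ?f (\<lambda>i\<in>?K. X i \<omega>, X j \<omega>))"
      using assms by (auto intro!: integrable_mult_of_squares integrable_resid_X)
    show "(\<integral>y. ?f (a, y) \<partial>P) = 0" for a
      by (simp add: law.integral_resid)
  qed (use assms in auto)
  then show ?thesis by simp
qed

lemma resid_orthogonal: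
  assumes "i \<noteq> j" "k \<noteq> l" "{i, j} \<noteq> {k, l}"
  shows "expectation (\<lambda>\<omega>. law.resid (X i \<omega>, X j \<omega>) * law.resid (X k \<omega>, X l \<omega>)) = 0"
proof (cases "j \<in> {k, l}")
  case False
  with assms show ?thesis by (intro resid_orthogonal_new_index) auto
next
  case True
  with assms have "i \<noteq> k" "i \<noteq> l" by auto
  with assms have "expectation (\<lambda>\<omega>. law.resid (X j \<omega>, X i \<omega>) * law.resid (X k \<omega>, X l \<omega>)) = 0"
    by (intro resid_orthogonal_new_index) auto
  then show ?thesis by (simp add: law.resid_commute)
qed

lemma
  shows integrable_resid_sum:
      "integrable M (\<lambda>\<omega>. (\<Sum>p\<in>offdiag n. law.resid (X (fst p) \<omega>, X (snd p) \<omega>))\<^sup>2)"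
    and second_moment_resid_sum:
      "expectation (\<lambda>\<omega>. (\<Sum>p\<in>offdiag n. law.resid (X (fst p) \<omega>, X (snd p) \<omega>))\<^sup>2)
        \<le> real (n * (n - 1)) * 2 * (\<integral>z. (law.resid z)\<^sup>2 \<partial>(P \<Otimes>\<^sub>M P))"
proof -
  let ?Z = "\<lambda>p \<omega>. law.resid (X (fst p) \<omega>, X (snd p) \<omega>)"
  have distinct: "fst p \<noteq> snd p" if "p \<in> offdiag n" for p
    using that by (auto simp: offdiag_def)
  have degree: "card {q \<in> offdiag n. expectation (\<lambda>\<omega>. ?Z p \<omega> * ?Z q \<omega>) \<noteq> 0} \<le> 2"
    if p: "p \<in> offdiag n" for p
  proof -
    have "{q \<in> offdiag n. expectation (\<lambda>\<omega>. ?Z p \<omega> * ?Z q \<omega>) \<noteq> 0} \<subseteq> {p, prod.swap p}"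
    proof
      fix q assume "q \<in> {q \<in> offdiag n. expectation (\<lambda>\<omega>. ?Z p \<omega> * ?Z q \<omega>) \<noteq> 0}"
      then have q: "q \<in> offdiag n" "expectation (\<lambda>\<omega>. ?Z p \<omega> * ?Z q \<omega>) \<noteq> 0" by auto
      have "{fst p, snd p} = {fst q, snd q}"
        using resid_orthogonal[OF distinct[OF p] distinct[OF q(1)]] q(2) by blast
      then show "q \<in> {p, prod.swap p}"
        by (cases p; cases q) (auto simp: doubleton_eq_iff)
    qed
    then have "card {q \<in> offdiag n. expectation (\<lambda>\<omega>. ?Z p \<omega> * ?Z q \<omega>) \<noteq> 0} \<le> card {p, prod.swap p}"
      by (intro card_mono) auto
    also have "\<dots> \<le> 2" by (simp add: card_insert_if)
    finally show ?thesis .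
  qed
  have rv: "random_variable borel (?Z p)" for p by measurable
  show "integrable M (\<lambda>\<omega>. (\<Sum>p\<in>offdiag n. ?Z p \<omega>)\<^sup>2)"
    by (rule integrable_square_sum[where d=2 and c="\<integral>z. (law.resid z)\<^sup>2 \<partial>(P \<Otimes>\<^sub>M P)"])
       (use distinct rv degree in \<open>auto simp: integrable_resid_X expectation_resid_X\<close>)
  have "expectation (\<lambda>\<omega>. (\<Sum>p\<in>offdiag n. ?Z p \<omega>)\<^sup>2)
      \<le> real (card (offdiag n)) * real 2 * (\<integral>z. (law.resid z)\<^sup>2 \<partial>(P \<Otimes>\<^sub>M P))"
    by (rule second_moment_sum_le)
       (use distinct rv degree in \<open>auto simp: integrable_resid_X expectation_resid_X\<close>)
  then show "expectation (\<lambda>\<omega>. (\<Sum>p\<in>offdiag n. ?Z p \<omega>)\<^sup>2)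
      \<le> real (n * (n - 1)) * 2 * (\<integral>z. (law.resid z)\<^sup>2 \<partial>(P \<Otimes>\<^sub>M P))"
    by (simp add: card_offdiag)
qed

section \<open>The limit law for one sample\<close>

text \<open>
Chebyshev's inequality for the sample mean.
\<close>

lemma weak_law:
  assumes \<epsilon>: "0 < \<epsilon>" and n: "0 < n"
  shows "prob {\<omega> \<in> space M. \<epsilon> \<le> \<bar>sample_mean n (\<lambda>i. X i \<omega>) - law.mean\<bar>}
    \<le> (\<integral>x. (x - law.mean)\<^sup>2 \<partial>P) / \<epsilon>\<^sup>2 / real n"
proof -
  let ?h = "\<lambda>x. x - law.mean"
  let ?T = "\<lambda>\<omega>. (\<Sum>i<n. ?h (X i \<omega>)) / real n"
  let ?v = "\<integral>x. (?h x)\<^sup>2 \<partial>P"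
  have h[measurable]: "?h \<in> borel_measurable borel" by measurable
  have centered: "(\<integral>x. ?h x \<partial>P) = 0"
    using law.integrable_id law.prob_space by (simp add: law.mean_def)
  have sq: "integrable P (\<lambda>x. (?h x)\<^sup>2)"
    using law.integrable_square law.integrable_id by (simp add: power2_diff)
  have sq_T: "integrable M (\<lambda>\<omega>. (?T \<omega>)\<^sup>2)"
    using integrable_centered_sum[OF h centered sq, of n] by (simp add: power_divide)
  have "integrable M (\<lambda>\<omega>. ?h (X i \<omega>))" for i
    using integrable_X[OF h, of i] law.integrable_id by simp
  then have mean_T: "expectation ?T = 0"
    using expectation_X[OF h] centered by simp
  have dev: "sample_mean n (\<lambda>i. X i \<omega>) - law.mean = ?T \<omega>" for \<omega>
    using n by (simp add: sample_mean_def sum_subtractf diff_divide_distrib)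
  have "prob {\<omega> \<in> space M. \<epsilon> \<le> \<bar>?T \<omega> - expectation ?T\<bar>} \<le> variance ?T / \<epsilon>\<^sup>2"
    by (rule Chebyshev_inequality[OF _ sq_T \<epsilon>]) measurable
  then have "prob {\<omega> \<in> space M. \<epsilon> \<le> \<bar>?T \<omega>\<bar>} \<le> expectation (\<lambda>\<omega>. (?T \<omega>)\<^sup>2) / \<epsilon>\<^sup>2"
    unfolding mean_T by simp
  also have "expectation (\<lambda>\<omega>. (?T \<omega>)\<^sup>2) = expectation (\<lambda>\<omega>. (\<Sum>i<n. ?h (X i \<omega>))\<^sup>2) / (real n)\<^sup>2"
    by (simp add: power_divide)
  also have "\<dots> \<le> (real n * ?v) / (real n)\<^sup>2"
    by (intro divide_right_mono second_moment_centered_sum h centered sq) simp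
  also have "\<dots> = ?v / real n" using n by (simp add: power2_eq_square)
  finally show ?thesis
    unfolding dev by (simp add: divide_right_mono field_simps)
qed

lemma mean_ratio_tendsto_1:
  assumes n: "\<And>k. 2 \<le> n k" "filterlim n at_top sequentially" and \<epsilon>: "0 < \<epsilon>"
  shows "(\<lambda>k. prob {\<omega> \<in> space M. \<epsilon> \<le> \<bar>law.mean / sample_mean (n k) (\<lambda>i. X i \<omega>) - 1\<bar>}) \<longlonglongrightarrow> 0"
proof -
  \<comment> \<open>Chosen so that \<open>law.mean - \<eta> = law.mean / (1 + \<epsilon>)\<close>: a sample mean within \<open>\<eta>\<close> stays above this value.\<close>
  define \<eta> where "\<eta> = law.mean * \<epsilon> / (1 + \<epsilon>)"
  have \<eta>: "0 < \<eta>" using \<epsilon> law.mean_pos by (simp add: \<eta>_def)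
  let ?s = "\<lambda>k \<omega>. sample_mean (n k) (\<lambda>i. X i \<omega>)"
  have sm[measurable]: "random_variable borel (?s k)" for k
    unfolding sample_mean_def by measurable
  have close: "\<bar>law.mean / s - 1\<bar> < \<epsilon>" if "\<bar>s - law.mean\<bar> < \<eta>" for s
  proof -
    have "law.mean - \<eta> = law.mean / (1 + \<epsilon>)" using \<epsilon> by (simp add: \<eta>_def field_simps)
    then have s: "law.mean / (1 + \<epsilon>) < s" using that by simp
    moreover have pos: "0 < law.mean / (1 + \<epsilon>)" using \<epsilon> law.mean_pos by simp
    ultimately have s0: "0 < s" by linarith
    have "\<epsilon> * (law.mean / (1 + \<epsilon>)) < \<epsilon> * s" using s \<epsilon> by (rule mult_strict_left_mono)
    then have "\<eta> < \<epsilon> * s" by (simp add: \<eta>_def mult.commute)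
    with that have "\<bar>s - law.mean\<bar> < \<epsilon> * s" by simp
    moreover have "law.mean / s - 1 = (law.mean - s) / s" using s0 by (simp add: field_simps)
    ultimately show ?thesis using s0 by (simp add: abs_divide abs_minus_commute divide_less_eq)
  qed
  have bound: "prob {\<omega> \<in> space M. \<epsilon> \<le> \<bar>law.mean / ?s k \<omega> - 1\<bar>}
      \<le> (\<integral>x. (x - law.mean)\<^sup>2 \<partial>P) / \<eta>\<^sup>2 / real (n k)" for k
  proof -
    have "prob {\<omega> \<in> space M. \<epsilon> \<le> \<bar>law.mean / ?s k \<omega> - 1\<bar>} \<le> prob {\<omega> \<in> space M. \<eta> \<le> \<bar>?s k \<omega> - law.mean\<bar>}"
    proof (rule finite_measure_mono)
      show "{\<omega> \<in> space M. \<epsilon> \<le> \<bar>law.mean / ?s k \<omega> - 1\<bar>} \<subseteq> {\<omega> \<in> space M. \<eta> \<le> \<bar>?s k \<omega> - law.mean\<bar>}"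
        using close by (fastforce simp: not_less[symmetric])
    qed measurable
    also have "\<dots> \<le> (\<integral>x. (x - law.mean)\<^sup>2 \<partial>P) / \<eta>\<^sup>2 / real (n k)"
      using n(1)[of k] by (intro weak_law \<eta>) auto
    finally show ?thesis .
  qed
  have "(\<lambda>k. (\<integral>x. (x - law.mean)\<^sup>2 \<partial>P) / \<eta>\<^sup>2 / real (n k)) \<longlonglongrightarrow> 0"
    by (rule real_tendsto_divide_at_top[OF tendsto_const filterlim_compose[OF filterlim_real_sequentially n(2)]])
  then show ?thesis
    by (rule Lim_null_comparison[rotated]) (use bound in \<open>simp add: always_eventually\<close>)
qed

text \<open>
The standard deviation of \<open>law.proj (X i)\<close>, a centered variable.
\<close>

definition \<sigma> :: real where
  "\<sigma> = sqrt (\<integral>x. (law.proj x)\<^sup>2 \<partial>P)"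

lemma \<sigma>_pos: "0 < \<sigma>"
  using law.proj_variance_pos by (simp add: \<sigma>_def)

lemma \<sigma>_square: "\<sigma>\<^sup>2 = (\<integral>x. (law.proj x)\<^sup>2 \<partial>P)"
  using law.proj_variance_pos by (simp add: \<sigma>_def)

text \<open>
The linear part of the normalized U-statistic, scaled to unit variance, and its degenerate part on the
same scale.
\<close>

definition proj_sum :: "nat \<Rightarrow> 'a \<Rightarrow> real" where
  "proj_sum n \<omega> = (\<Sum>i<n. law.proj (X i \<omega>)) / sqrt (real n * \<sigma>\<^sup>2)"

definition resid_sum :: "nat \<Rightarrow> 'a \<Rightarrow> real" where
  "resid_sum n \<omega> = sqrt (real n) * (\<Sum>p\<in>offdiag n. law.resid (X (fst p) \<omega>, X (snd p) \<omega>))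
    / (2 * \<sigma> * (real n * (real n - 1)))"

lemma proj_sum_measurable [measurable]: "random_variable borel (proj_sum n)"
  unfolding proj_sum_def[abs_def] by measurable

lemma resid_sum_measurable [measurable]: "random_variable borel (resid_sum n)"
  unfolding resid_sum_def[abs_def] by measurable

text \<open>
All of the limiting randomness comes from this sum of independent variables.
\<close>

lemma clt_proj_sum: "weak_conv_m (\<lambda>n. distr M borel (proj_sum n)) std_normal_distribution"
proof -
  have "weak_conv_m (\<lambda>n. distr M borel (\<lambda>\<omega>. (\<Sum>i<n. law.proj (X i \<omega>)) / sqrt (real n * \<sigma>\<^sup>2)))
    std_normal_distribution"
  proof (rule central_limit_theorem_zero_mean)
    show "indep_vars (\<lambda>i. borel) (\<lambda>i \<omega>. law.proj (X i \<omega>)) UNIV"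
      by (rule indep_vars_compose2[OF indep]) simp
    show mean: "expectation (\<lambda>\<omega>. law.proj (X i \<omega>)) = 0" for i
      by (simp add: expectation_X law.integral_proj)
    show "integrable M (\<lambda>\<omega>. (law.proj (X i \<omega>))\<^sup>2)" for i
      using integrable_X[of "\<lambda>x. (law.proj x)\<^sup>2" i] law.integrable_proj_square by simp
    show "variance (\<lambda>\<omega>. law.proj (X i \<omega>)) = \<sigma>\<^sup>2" for i
      using expectation_X[of "\<lambda>x. (law.proj x)\<^sup>2" i] unfolding mean \<sigma>_square by simp
    show "distr M borel (\<lambda>\<omega>. law.proj (X i \<omega>)) = distr P borel law.proj" for i
    proof -
      have "distr P borel law.proj = distr (distr M borel (X i)) borel law.proj"
        by (simp only: distr_X)
      also have "\<dots> = distr M borel (\<lambda>\<omega>. law.proj (X i \<omega>))"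
        by (subst distr_distr) (simp_all add: comp_def)
      finally show ?thesis ..
    qed
  qed (rule \<sigma>_pos)
  then show ?thesis by (simp add: proj_sum_def[abs_def])
qed

lemma
  shows integrable_proj_sum_square: "integrable M (\<lambda>\<omega>. (proj_sum n \<omega>)\<^sup>2)"
    and abs_proj_sum_le: "expectation (\<lambda>\<omega>. \<bar>proj_sum n \<omega>\<bar>) \<le> 1"
proof -
  note * = law.proj_measurable law.integral_proj law.integrable_proj_square
  have eq: "(proj_sum n \<omega>)\<^sup>2 = (\<Sum>i<n. law.proj (X i \<omega>))\<^sup>2 / (real n * \<sigma>\<^sup>2)" for \<omega>
    by (simp add: proj_sum_def power_divide)
  show sq: "integrable M (\<lambda>\<omega>. (proj_sum n \<omega>)\<^sup>2)"
    unfolding eq using integrable_centered_sum[OF *, of n] by simp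
  have "expectation (\<lambda>\<omega>. (proj_sum n \<omega>)\<^sup>2) = expectation (\<lambda>\<omega>. (\<Sum>i<n. law.proj (X i \<omega>))\<^sup>2) / (real n * \<sigma>\<^sup>2)"
    unfolding eq by simp
  also have "\<dots> \<le> (real n * \<sigma>\<^sup>2) / (real n * \<sigma>\<^sup>2)"
    unfolding \<sigma>_square by (intro divide_right_mono second_moment_centered_sum *)
      (use law.proj_variance_pos in auto)
  also have "\<dots> \<le> 1" by simp
  finally show "expectation (\<lambda>\<omega>. \<bar>proj_sum n \<omega>\<bar>) \<le> 1"
    using expectation_abs_le_sqrt[OF proj_sum_measurable sq, of 1] by simp
qed

lemma
  assumes n: "2 \<le> n"
  shows integrable_resid_sum_square: "integrable M (\<lambda>\<omega>. (resid_sum n \<omega>)\<^sup>2)"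
    and abs_resid_sum_le: "expectation (\<lambda>\<omega>. \<bar>resid_sum n \<omega>\<bar>)
      \<le> sqrt ((\<integral>z. (law.resid z)\<^sup>2 \<partial>(P \<Otimes>\<^sub>M P)) / (2 * \<sigma>\<^sup>2) / (real n - 1))"
proof -
  let ?R = "\<lambda>\<omega>. \<Sum>p\<in>offdiag n. law.resid (X (fst p) \<omega>, X (snd p) \<omega>)"
  let ?c = "\<integral>z. (law.resid z)\<^sup>2 \<partial>(P \<Otimes>\<^sub>M P)"
  let ?N = "real n * (real n - 1)"
  have N: "0 < ?N" using n by simp
  have eq: "(resid_sum n \<omega>)\<^sup>2 = real n / (4 * \<sigma>\<^sup>2 * ?N\<^sup>2) * (?R \<omega>)\<^sup>2" for \<omega>
    by (simp add: resid_sum_def power_divide power_mult_distrib)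
  show sq: "integrable M (\<lambda>\<omega>. (resid_sum n \<omega>)\<^sup>2)"
    unfolding eq using integrable_resid_sum[of n] by simp
  have "expectation (\<lambda>\<omega>. (resid_sum n \<omega>)\<^sup>2) = real n / (4 * \<sigma>\<^sup>2 * ?N\<^sup>2) * expectation (\<lambda>\<omega>. (?R \<omega>)\<^sup>2)"
    unfolding eq by simp
  also have "\<dots> \<le> real n / (4 * \<sigma>\<^sup>2 * ?N\<^sup>2) * (real (n * (n - 1)) * 2 * ?c)"
    by (intro mult_left_mono second_moment_resid_sum) simp
  also have "real (n * (n - 1)) = ?N" using n by (simp add: of_nat_diff)
  also have "real n / (4 * \<sigma>\<^sup>2 * ?N\<^sup>2) * (?N * 2 * ?c) = real n / (?N) * ?c / (2 * \<sigma>\<^sup>2)"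
    using N by (simp add: power2_eq_square[of "?N"])
  also have "\<dots> = ?c / (2 * \<sigma>\<^sup>2) / (real n - 1)" using n by simp
  finally show "expectation (\<lambda>\<omega>. \<bar>resid_sum n \<omega>\<bar>) \<le> sqrt (?c / (2 * \<sigma>\<^sup>2) / (real n - 1))"
    by (intro expectation_abs_le_sqrt resid_sum_measurable sq)
qed

lemma AE_sample_mean_pos:
  assumes n: "0 < n"
  shows "AE \<omega> in M. 0 < sample_mean n (\<lambda>i. X i \<omega>)"
proof -
  have "AE \<omega> in M. 0 < X i \<omega>" for i
    using law.positive unfolding distr_X[of i, symmetric] by (subst (asm) AE_distr_iff) auto
  then have "AE \<omega> in M. \<forall>i\<in>{..<n}. 0 < X i \<omega>"
    by (intro AE_finite_allI) auto
  then show ?thesis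
  proof eventually_elim
    case (elim \<omega>)
    with n have "0 < (\<Sum>i<n. X i \<omega>)" by (intro sum_pos) auto
    with n show ?case by (simp add: sample_mean_def)
  qed
qed

definition normalized_error :: "nat \<Rightarrow> 'a \<Rightarrow> real" where
  "normalized_error n \<omega> =
    sqrt (real n) * (delta_hat n (\<lambda>i. X i \<omega>) - law.ratio) / sqrt (asymp_var (cdf P))"

lemma delta_hat_X_measurable [measurable]: "random_variable borel (\<lambda>\<omega>. delta_hat n (\<lambda>i. X i \<omega>))"
proof -
  have "(\<lambda>\<omega>. (\<Sum>p\<in>offdiag n. max (X (fst p) \<omega>) (X (snd p) \<omega>))
      / (real n * (real n - 1) * ((1 / real n) * (\<Sum>i<n. X i \<omega>)))) \<in> borel_measurable M"
    by measurable
  then show ?thesis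
    by (simp add: delta_hat_eq sample_mean_def)
qed

lemma normalized_error_measurable [measurable]: "random_variable borel (normalized_error n)"
  unfolding normalized_error_def[abs_def] by measurable

lemma sqrt_asymp_var: "sqrt (asymp_var (cdf P)) = 2 * \<sigma> / law.mean"
proof -
  have "asymp_var (cdf P) = (2 * \<sigma> / law.mean)\<^sup>2"
    by (simp add: law.asymp_var_cdf power_divide power_mult_distrib \<sigma>_square)
  then show ?thesis using \<sigma>_pos law.mean_pos by simp
qed

text \<open>
The factor \<open>\<mu> / sample mean\<close> tends to 1; it stems from \<open>sqrt (asymp_var (cdf P)) = 2 \<sigma> / \<mu>\<close>.
\<close>

lemma normalized_error_eq:
  assumes n: "2 \<le> n" and nz: "sample_mean n (\<lambda>i. X i \<omega>) \<noteq> 0"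
  shows "normalized_error n \<omega>
    = (proj_sum n \<omega> + resid_sum n \<omega>) * (law.mean / sample_mean n (\<lambda>i. X i \<omega>))"
proof -
  let ?G = "\<Sum>i<n. law.proj (X i \<omega>)"
  let ?R = "\<Sum>p\<in>offdiag n. law.resid (X (fst p) \<omega>, X (snd p) \<omega>)"
  let ?m = "sample_mean n (\<lambda>i. X i \<omega>)" and ?N = "real n * (real n - 1)"
  have "normalized_error n \<omega> = sqrt (real n) * ((2 / real n * ?G + ?R / ?N) / ?m) / (2 * \<sigma> / law.mean)"
    by (simp only: normalized_error_def law.delta_hat_decomposition[OF n nz] sqrt_asymp_var)
  also have "\<dots> = (sqrt (real n) * (2 / real n * ?G) / (2 * \<sigma>) + sqrt (real n) * (?R / ?N) / (2 * \<sigma>))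
      * (law.mean / ?m)"
  proof -
    have "s * ((A + B) / m) / (2 * g / u) = (s * A / (2 * g) + s * B / (2 * g)) * (u / m)"
      for s A B m g u :: real
    proof -
      have "s * A / (2 * g) + s * B / (2 * g) = s * (A + B) / (2 * g)"
        by (simp add: add_divide_distrib[symmetric] distrib_left)
      then show ?thesis by (simp add: mult_ac)
    qed
    then show ?thesis .
  qed
  also have "sqrt (real n) * (2 / real n * ?G) / (2 * \<sigma>) = proj_sum n \<omega>"
  proof -
    have "sqrt (real n) * (2 / real n * ?G) / (2 * \<sigma>) = sqrt (real n) / real n * ?G / \<sigma>"
      by simp
    also have "sqrt (real n) / real n = 1 / sqrt (real n)"
      using n by (simp add: field_simps)
    finally show ?thesis using \<sigma>_pos by (simp add: proj_sum_def real_sqrt_mult)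
  qed
  also have "sqrt (real n) * (?R / ?N) / (2 * \<sigma>) = resid_sum n \<omega>"
    by (simp add: resid_sum_def)
  finally show ?thesis .
qed

lemma normalized_error_clt:
  assumes n: "\<And>k. 2 \<le> n k" "filterlim n at_top sequentially"
  shows "weak_conv_m (\<lambda>k. distr M borel (normalized_error (n k))) std_normal_distribution"
proof -
  let ?U = "\<lambda>k \<omega>. proj_sum (n k) \<omega> + resid_sum (n k) \<omega>"
  let ?Q = "\<lambda>k \<omega>. law.mean / sample_mean (n k) (\<lambda>i. X i \<omega>)"
  let ?c = "(\<integral>z. (law.resid z)\<^sup>2 \<partial>(P \<Otimes>\<^sub>M P)) / (2 * \<sigma>\<^sup>2)"
  have int_proj: "integrable M (proj_sum (n k))" for k
    by (rule square_integrable_imp_integrable[OF _ integrable_proj_sum_square]) measurable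
  have int_resid: "integrable M (resid_sum (n k))" for k
    by (rule square_integrable_imp_integrable[OF _ integrable_resid_sum_square[OF n(1)]]) measurable
  have proj: "weak_conv_m (\<lambda>k. distr M borel (proj_sum (n k))) std_normal_distribution"
    using clt_proj_sum n(2) unfolding weak_conv_m_def weak_conv_def
    by (auto intro: filterlim_compose)
  have c: "0 \<le> ?c" by (intro divide_nonneg_nonneg Bochner_Integration.integral_nonneg) auto
  have resid_null: "(\<lambda>k. expectation (\<lambda>\<omega>. \<bar>resid_sum (n k) \<omega>\<bar>)) \<longlonglongrightarrow> 0"
  proof (rule Lim_null_comparison)
    show "\<forall>\<^sub>F k in sequentially. norm (expectation (\<lambda>\<omega>. \<bar>resid_sum (n k) \<omega>\<bar>)) \<le> sqrt (?c / (real (n k) - 1))"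
      using abs_resid_sum_le[OF n(1)] by (auto intro!: always_eventually)
    have "filterlim (\<lambda>k. real (n k) - 1) at_top sequentially"
      using filterlim_tendsto_add_at_top[OF tendsto_const[of "-1"]
          filterlim_compose[OF filterlim_real_sequentially n(2)]] by simp
    from real_tendsto_divide_at_top[OF tendsto_const this, of ?c]
    show "(\<lambda>k. sqrt (?c / (real (n k) - 1))) \<longlonglongrightarrow> 0"
      using tendsto_real_sqrt by fastforce
  qed
  have U: "weak_conv_m (\<lambda>k. distr M borel (?U k)) std_normal_distribution"
    by (rule weak_conv_m_add_null[OF _ _ real_dist_normal_dist proj])
       (use int_resid resid_null in simp_all)
  have U_bound: "expectation (\<lambda>\<omega>. \<bar>?U k \<omega>\<bar>) \<le> 1 + sqrt ?c" for k
  proof -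
    have "expectation (\<lambda>\<omega>. \<bar>?U k \<omega>\<bar>) \<le> expectation (\<lambda>\<omega>. \<bar>proj_sum (n k) \<omega>\<bar> + \<bar>resid_sum (n k) \<omega>\<bar>)"
      using int_proj[of k] int_resid[of k] by (intro integral_mono) auto
    also have "\<dots> = expectation (\<lambda>\<omega>. \<bar>proj_sum (n k) \<omega>\<bar>) + expectation (\<lambda>\<omega>. \<bar>resid_sum (n k) \<omega>\<bar>)"
      using int_proj[of k] int_resid[of k] by simp
    also have "\<dots> \<le> 1 + sqrt (?c / (real (n k) - 1))"
      by (intro add_mono abs_proj_sum_le abs_resid_sum_le n(1))
    also have "\<dots> \<le> 1 + sqrt ?c"
    proof -
      have "?c / (real (n k) - 1) \<le> ?c / 1" using n(1)[of k] c by (intro divide_left_mono) auto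
      then show ?thesis by simp
    qed
    finally show ?thesis .
  qed
  have Q: "random_variable borel (?Q k)" for k
    unfolding sample_mean_def by measurable
  have UQ: "weak_conv_m (\<lambda>k. distr M borel (\<lambda>\<omega>. ?U k \<omega> * ?Q k \<omega>)) std_normal_distribution"
    by (rule weak_conv_m_mult_one[OF _ Q real_dist_normal_dist U _ U_bound])
       (use int_proj int_resid mean_ratio_tendsto_1[OF n] in simp_all)
  have "distr M borel (normalized_error (n k)) = distr M borel (\<lambda>\<omega>. ?U k \<omega> * ?Q k \<omega>)" for k
  proof (rule distr_cong_AE)
    show "AE \<omega> in M. normalized_error (n k) \<omega> = ?U k \<omega> * ?Q k \<omega>"
      using AE_sample_mean_pos[of "n k"] n(1)[of k] by (auto elim!: eventually_mono simp: normalized_error_eq)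
    show "(\<lambda>\<omega>. ?U k \<omega> * ?Q k \<omega>) \<in> borel_measurable M" using Q by measurable
  qed simp_all
  with UQ show ?thesis by simp
qed

end

section \<open>Two independent samples\<close>

text \<open>
The density makes the law free of atoms; in particular it does not charge 0, so that nonnegative
observations are almost surely positive.
\<close>

lemma (in prob_space) iid_lifetimes_of_cdf:
  assumes indep: "indep_vars (\<lambda>_. borel) X UNIV"
    and nonneg: "\<And>i. AE \<omega> in M. 0 \<le> X i \<omega>"
    and cdf: "\<And>i. cdf (distr M borel (X i)) = F"
    and density: "has_density F"
    and int: "integrable (interval_measure F) (\<lambda>x. x)"
    and sq: "integrable M (\<lambda>\<omega>. (max (X 0 \<omega>) (X 1 \<omega>) - delta F / 2 * (X 0 \<omega> + X 1 \<omega>))\<^sup>2)"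
  shows "iid_lifetimes M (interval_measure F) X"
    and "cdf (interval_measure F) = F"
proof -
  have rv[measurable]: "random_variable borel (X i)" for i
    using indep unfolding indep_vars_def2 by simp
  interpret D: real_distribution "distr M borel (X i)" for i
    by (rule real_distribution_distr) measurable
  have law: "distr M borel (X i) = interval_measure F" for i
    using D.interval_measure_cdf[of i] by (simp add: cdf)
  let ?P = "interval_measure F"
  show cdf_P: "cdf ?P = F" using cdf[of 0] by (simp add: law)
  interpret P: real_distribution ?P using D.real_distribution_axioms[of 0] by (simp add: law)
  obtain h where h: "h \<in> borel_measurable lborel" "?P = density lborel h"
    using density by (auto simp: has_density_def)
  have null: "{x} \<in> null_sets ?P" for x
  proof -
    have "{x} \<in> null_sets lborel" by (rule null_setsI) simp_all
    then show ?thesis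
      using absolutely_continuousI_density[OF h(1)] unfolding h(2) absolutely_continuous_def by blast
  qed
  have atomless: "measure ?P {x} = 0" for x
    using null[of x] by (simp add: null_sets_def measure_def)
  have "AE x in ?P. 0 \<le> x"
    using nonneg[of 0] unfolding law[of 0, symmetric] by (subst AE_distr_iff) auto
  moreover have "AE x in ?P. x \<notin> {0}"
    by (rule AE_not_in[OF null])
  ultimately have pos: "AE x in ?P. 0 < x"
    by eventually_elim auto
  interpret P: diffuse_lifetime_law ?P
    by unfold_locales (use pos atomless int in auto)
  interpret iid_sample M ?P X
    by unfold_locales (use indep law in auto)
  let ?k = "\<lambda>z. (max (fst z) (snd z) - P.ratio / 2 * (fst z + snd z))\<^sup>2"
  have "integrable M (\<lambda>\<omega>. ?k (X 0 \<omega>, X 1 \<omega>))"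
    using sq P.delta_cdf by (simp add: cdf_P)
  then have "integrable (?P \<Otimes>\<^sub>M ?P) ?k"
    unfolding distr_X_pair[of 0 1, OF zero_neq_one, symmetric] by (subst integrable_distr_eq) auto
  then have "integrable ?P (\<lambda>x. x\<^sup>2)" by (rule P.square_integrable_id)
  then show "iid_lifetimes M ?P X"
    by unfold_locales
qed

lemma (in prob_space) char_distr_cmult:
  assumes [measurable]: "random_variable borel U"
  shows "char (distr M borel (\<lambda>\<omega>. a * U \<omega>)) t = char (distr M borel U) (a * t)"
  by (simp add: char_def integral_distr mult_ac)

text \<open>
By independence the characteristic function factorizes, and the two limits
\<open>exp (- a\<^sup>2 t\<^sup>2 / 2)\<close> and \<open>exp (- b\<^sup>2 t\<^sup>2 / 2)\<close> multiply to that of the standard normal law because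
\<open>a\<^sup>2 + b\<^sup>2 = 1\<close>.
\<close>

lemma (in prob_space) weak_conv_m_indep_normal_combination:
  assumes indep: "\<And>k. indep_var borel (U k) borel (V k)"
    and U: "weak_conv_m (\<lambda>k. distr M borel (U k)) std_normal_distribution"
    and V: "weak_conv_m (\<lambda>k. distr M borel (V k)) std_normal_distribution"
    and \<alpha>: "\<alpha> \<longlonglongrightarrow> a" and \<beta>: "\<beta> \<longlonglongrightarrow> b" and unit: "a\<^sup>2 + b\<^sup>2 = 1"
  shows "weak_conv_m (\<lambda>k. distr M borel (\<lambda>\<omega>. \<alpha> k * U k \<omega> + \<beta> k * V k \<omega>)) std_normal_distribution"
proof (rule levy_continuity)
  have [measurable]: "random_variable borel (U k)" "random_variable borel (V k)" for k
    using indep_var_rv1[OF indep] indep_var_rv2[OF indep] by auto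
  show "real_distribution (distr M borel (\<lambda>\<omega>. \<alpha> k * U k \<omega> + \<beta> k * V k \<omega>))" for k
    by (rule real_distribution_distr) measurable
  fix t
  have char_eq: "char (distr M borel (\<lambda>\<omega>. \<alpha> k * U k \<omega> + \<beta> k * V k \<omega>)) t
      = char (distr M borel (U k)) (\<alpha> k * t) * char (distr M borel (V k)) (\<beta> k * t)" for k
  proof -
    have "indep_var borel ((\<lambda>x. \<alpha> k * x) \<circ> U k) borel ((\<lambda>x. \<beta> k * x) \<circ> V k)"
      by (rule indep_var_compose[OF indep]) auto
    then have "indep_var borel (\<lambda>\<omega>. \<alpha> k * U k \<omega>) borel (\<lambda>\<omega>. \<beta> k * V k \<omega>)"
      by (simp add: comp_def)
    from char_distr_add[OF this, of t] show ?thesis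
      by (simp add: char_distr_cmult)
  qed
  have U_lim: "(\<lambda>k. char (distr M borel (U k)) (\<alpha> k * t)) \<longlonglongrightarrow> char std_normal_distribution (a * t)"
    by (rule char_tendsto_moving_argument[OF _ real_dist_normal_dist U])
       (auto intro!: tendsto_intros \<alpha>)
  have V_lim: "(\<lambda>k. char (distr M borel (V k)) (\<beta> k * t)) \<longlonglongrightarrow> char std_normal_distribution (b * t)"
    by (rule char_tendsto_moving_argument[OF _ real_dist_normal_dist V])
       (auto intro!: tendsto_intros \<beta>)
  have std: "char std_normal_distribution (a * t) * char std_normal_distribution (b * t)
      = char std_normal_distribution t"
  proof -
    have "- (a * t)\<^sup>2 / 2 + - (b * t)\<^sup>2 / 2 = - ((a\<^sup>2 + b\<^sup>2) * t\<^sup>2) / 2"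
      by (simp add: power_mult_distrib field_simps)
    then have "exp (- (a * t)\<^sup>2 / 2) * exp (- (b * t)\<^sup>2 / 2) = exp (- (t\<^sup>2) / 2)"
      by (simp only: exp_add[symmetric] unit mult_1)
    then show ?thesis
      unfolding char_std_normal_distribution of_real_mult[symmetric] by simp
  qed
  show "(\<lambda>k. char (distr M borel (\<lambda>\<omega>. \<alpha> k * U k \<omega> + \<beta> k * V k \<omega>)) t)
      \<longlonglongrightarrow> char std_normal_distribution t"
    unfolding char_eq std[symmetric] by (rule tendsto_mult[OF U_lim V_lim])
qed (rule real_dist_normal_dist)

text \<open>
Dividing by the combined standard deviation \<open>s k\<close> gives the two samples weights whose squares are their
shares in the total variance. These shares add up to 1, and converge because \<open>n k / (n k + m k)\<close> does, to
a limit strictly between 0 and 1. The second sample enters with a negative sign.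
\<close>

lemma variance_shares_tendsto:
  fixes n m :: "nat \<Rightarrow> nat" and v w c :: real
  assumes n: "\<And>k. 2 \<le> n k" and m: "\<And>k. 2 \<le> m k" and c: "0 < c" "c < 1"
    and lim: "(\<lambda>k. real (n k) / real (n k + m k)) \<longlonglongrightarrow> c" and v: "0 < v" and w: "0 < w"
  defines "s \<equiv> \<lambda>k. sqrt (real (n k + m k) / real (n k) * v + real (n k + m k) / real (m k) * w)"
  obtains a b where "(\<lambda>k. sqrt (real (n k + m k) / real (n k)) * sqrt v / s k) \<longlonglongrightarrow> a"
    and "(\<lambda>k. - sqrt (real (n k + m k) / real (m k)) * sqrt w / s k) \<longlonglongrightarrow> b"
    and "a\<^sup>2 + b\<^sup>2 = 1"
proof -
  let ?N = "\<lambda>k. real (n k + m k)"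
  have "(\<lambda>k. inverse (real (n k) / ?N k)) \<longlonglongrightarrow> inverse c"
    by (rule tendsto_inverse[OF lim]) (use c in simp)
  then have lim_n: "(\<lambda>k. ?N k / real (n k)) \<longlonglongrightarrow> 1 / c"
    by (simp add: inverse_eq_divide)
  have share: "1 - real (n k) / ?N k = real (m k) / ?N k" for k
    using n[of k] by (simp add: field_simps)
  have "(\<lambda>k. inverse (1 - real (n k) / ?N k)) \<longlonglongrightarrow> inverse (1 - c)"
    by (rule tendsto_inverse[OF tendsto_diff[OF tendsto_const lim]]) (use c in simp)
  then have lim_m: "(\<lambda>k. ?N k / real (m k)) \<longlonglongrightarrow> 1 / (1 - c)"
    unfolding share by (simp add: inverse_eq_divide)
  let ?S = "1 / c * v + 1 / (1 - c) * w"
  have S: "0 < ?S" using c v w by (intro add_pos_pos) auto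
  have lim_s: "s \<longlonglongrightarrow> sqrt ?S"
    unfolding s_def by (intro tendsto_intros lim_n lim_m)
  let ?a = "sqrt (1 / c) * sqrt v / sqrt ?S" and ?b = "- sqrt (1 / (1 - c)) * sqrt w / sqrt ?S"
  show thesis
  proof
    show "(\<lambda>k. sqrt (?N k / real (n k)) * sqrt v / s k) \<longlonglongrightarrow> ?a"
      using S by (intro tendsto_intros lim_n lim_s) simp
    show "(\<lambda>k. - sqrt (?N k / real (m k)) * sqrt w / s k) \<longlonglongrightarrow> ?b"
      using S by (intro tendsto_intros lim_m lim_s) simp
    have "?a\<^sup>2 + ?b\<^sup>2 = (1 / c * v) / ?S + (1 / (1 - c) * w) / ?S"
      using c v w S by (simp only: power_divide power_mult_distrib power_minus_Bit0 power2_minus real_sqrt_pow2 less_imp_le)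
        (simp add: less_imp_le)
    also have "\<dots> = ?S / ?S" by (rule add_divide_distrib[symmetric])
    also have "\<dots> = 1" using S by (intro divide_self) linarith
    finally show "?a\<^sup>2 + ?b\<^sup>2 = 1" .
  qed
qed

theorem theorem3p1:
  fixes M :: "'a measure"
    and X Y :: "nat \<Rightarrow> 'a \<Rightarrow> real"
    and F G :: "real \<Rightarrow> real"
    and n m :: "nat \<Rightarrow> nat"
    and c :: real
  assumes "prob_space M"
    and "prob_space.indep_vars M (\<lambda>_. borel) X UNIV"
    and "prob_space.indep_vars M (\<lambda>_. borel) Y UNIV"
    and "prob_space.indep_var M
           (Pi\<^sub>M UNIV (\<lambda>_. borel)) (\<lambda>\<omega> i. X i \<omega>)
           (Pi\<^sub>M UNIV (\<lambda>_. borel)) (\<lambda>\<omega> i. Y i \<omega>)"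
    and "\<And>i. AE \<omega> in M. 0 \<le> X i \<omega>"
    and "\<And>i. AE \<omega> in M. 0 \<le> Y i \<omega>"
    and "\<And>i. cdf (distr M borel (X i)) = F"
    and "\<And>i. cdf (distr M borel (Y i)) = G"
    and "has_density F"
    and "has_density G"
    and "integrable (interval_measure F) (\<lambda>x. x)" and "0 < df_mean F"
    and "integrable (interval_measure G) (\<lambda>x. x)" and "0 < df_mean G"
    and "integrable M (\<lambda>\<omega>. (max (X 0 \<omega>) (X 1 \<omega>) - delta F / 2 * (X 0 \<omega> + X 1 \<omega>))\<^sup>2)"
    and "integrable M (\<lambda>\<omega>. (max (Y 0 \<omega>) (Y 1 \<omega>) - delta G / 2 * (Y 0 \<omega> + Y 1 \<omega>))\<^sup>2)"
    and "\<And>k. 2 \<le> n k"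
    and "\<And>k. 2 \<le> m k"
    and "filterlim n at_top sequentially"
    and "filterlim m at_top sequentially"
    and "0 < c" and "c \<le> 1 / 2"
    and "(\<lambda>k. real (n k) / real (n k + m k)) \<longlonglongrightarrow> c"
  shows "weak_conv_m
           (\<lambda>k. distr M borel (\<lambda>\<omega>.
              sqrt (real (n k + m k)) *
                ((delta_hat (n k) (\<lambda>i. X i \<omega>) - delta_hat (m k) (\<lambda>i. Y i \<omega>)) - (delta F - delta G))
                / sqrt (asymp_var2 F G (n k) (m k))))
           std_normal_distribution"
proof -
  interpret prob_space M by fact
  let ?P = "interval_measure F" and ?Q = "interval_measure G"
  note X = iid_lifetimes_of_cdf[OF assms(2,5,7,9,11,15)]
  note Y = iid_lifetimes_of_cdf[OF assms(3,6,8,10,13,16)]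
  interpret X: iid_lifetimes M ?P X by (rule X)
  interpret Y: iid_lifetimes M ?Q Y by (rule Y)
  have v: "0 < asymp_var F" "0 < asymp_var G"
    using X.law.asymp_var_pos Y.law.asymp_var_pos by (simp_all add: X(2) Y(2))
  have ratios: "delta F = X.law.ratio" "delta G = Y.law.ratio"
    using X.law.delta_cdf Y.law.delta_cdf by (simp_all add: X(2) Y(2))
  let ?U = "\<lambda>k. X.normalized_error (n k)" and ?V = "\<lambda>k. Y.normalized_error (m k)"
  have indep: "indep_var borel (?U k) borel (?V k)" for k
  proof -
    have "indep_var
        borel ((\<lambda>x. sqrt (real (n k)) * (delta_hat (n k) x - delta F) / sqrt (asymp_var F)) \<circ> (\<lambda>\<omega> i. X i \<omega>))
        borel ((\<lambda>y. sqrt (real (m k)) * (delta_hat (m k) y - delta G) / sqrt (asymp_var G)) \<circ> (\<lambda>\<omega> i. Y i \<omega>))"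
      by (rule indep_var_compose[OF assms(4)]) measurable
    then show ?thesis
      by (simp add: comp_def X.normalized_error_def[abs_def] Y.normalized_error_def[abs_def] ratios X(2) Y(2))
  qed
  let ?s = "\<lambda>k. sqrt (real (n k + m k) / real (n k) * asymp_var F + real (n k + m k) / real (m k) * asymp_var G)"
  let ?\<alpha> = "\<lambda>k. sqrt (real (n k + m k) / real (n k)) * sqrt (asymp_var F) / ?s k"
  let ?\<beta> = "\<lambda>k. - sqrt (real (n k + m k) / real (m k)) * sqrt (asymp_var G) / ?s k"
  have "c < 1" using assms(22) by simp
  from variance_shares_tendsto[OF assms(17,18,21) this assms(23) v]
  obtain a b where ab: "?\<alpha> \<longlonglongrightarrow> a" "?\<beta> \<longlonglongrightarrow> b" "a\<^sup>2 + b\<^sup>2 = 1" by blast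
  have "weak_conv_m (\<lambda>k. distr M borel (\<lambda>\<omega>. ?\<alpha> k * ?U k \<omega> + ?\<beta> k * ?V k \<omega>)) std_normal_distribution"
    by (rule weak_conv_m_indep_normal_combination[OF indep
          X.normalized_error_clt[OF assms(17,19)] Y.normalized_error_clt[OF assms(18,20)] ab])
  moreover have "?\<alpha> k * ?U k \<omega> + ?\<beta> k * ?V k \<omega> =
      sqrt (real (n k + m k)) *
        ((delta_hat (n k) (\<lambda>i. X i \<omega>) - delta_hat (m k) (\<lambda>i. Y i \<omega>)) - (delta F - delta G))
        / sqrt (asymp_var2 F G (n k) (m k))" for k \<omega>
  proof -
    have cancel: "sqrt (N / j) * sqrt u / s * (sqrt j * d / sqrt u) = sqrt N * d / s"
      if "0 < j" "0 < u" for N j u s d :: real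
      using that by (simp add: real_sqrt_divide)
    have cancel_minus: "- sqrt (N / j) * sqrt u / s * (sqrt j * d / sqrt u) = - (sqrt N * d / s)"
      if "0 < j" "0 < u" for N j u s d :: real
      using cancel[OF that, of N s d]
      by (simp only: minus_mult_left[symmetric] minus_divide_left[symmetric])
    have "?\<alpha> k * ?U k \<omega> = sqrt (real (n k + m k)) * (delta_hat (n k) (\<lambda>i. X i \<omega>) - delta F) / ?s k"
      using assms(17)[of k] v unfolding X.normalized_error_def ratios X(2) by (intro cancel) auto
    moreover have "?\<beta> k * ?V k \<omega> = - (sqrt (real (n k + m k)) * (delta_hat (m k) (\<lambda>i. Y i \<omega>) - delta G) / ?s k)"
      using assms(18)[of k] v unfolding Y.normalized_error_def ratios Y(2) by (intro cancel_minus) auto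
    ultimately show ?thesis
      by (simp only: asymp_var2_def) (simp add: diff_divide_distrib right_diff_distrib)
  qed
  ultimately show ?thesis by simp
qed

end
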